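(* Let $p<q$. (i) If $p\le -2$, $q\ge 2$ and $(p,q)\ne(-2,2)$, then $\frac{\partial\Theta}{\partial r}(p,q,r)>0$ for all $r>1$. (ii) If $q\ge 2$, $p\ge\frac{2q}{2+q}$ and $(p,q)\ne(1,2)$, then $\frac{\partial\Theta}{\partial r}(p,q,r)>0$ for all $r>1$. (iii) If $p\le-2$, $q\le\frac{2p}{2-p}$ and $(p,q)\ne(-2,-1)$, then $\frac{\partial\Theta}{\partial r}(p,q,r)>0$ for all $r>1$. (iv) If $q\ge\frac{2p}{2-p}$, $p\ge -2$, $q\le 2$ and $(p,q)\notin\{(0,0),(1,2),(-2,-1),(-2,2)\}$, then $\frac{\partial\Theta}{\partial r}(p,q,r)<0$ for all $r>1$.
   Context: For $p<q$ and $r>1$ define $$\Theta(p,q,r)=\int_1^r\frac{dx}{\sqrt{\left(\frac{r^p-r^q}{r^p-1}+\frac{r^q-1}{r^p-1}x^p\right)^{2/q}-x^2}}\quad (p\ne0,\ q\ne0),$$ $$\Theta(0,q,r)=\int_1^r\frac{dx}{\sqrt{\left(1+\frac{r^q-1}{\log r}\log x\right)^{2/q}-x^2}},\qquad \Theta(p,0,r)=\int_1^r\frac{dx}{\sqrt{r^{\frac{2(x^p-1)}{r^p-1}}-x^2}}.$$ Throughout, $\Theta$ is only considered on the domain $p<q$. *)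

theory Defs
  imports "HOL-Analysis.Analysis"
begin

definition Theta_F :: "real \<Rightarrow> real \<Rightarrow> real \<Rightarrow> real \<Rightarrow> real" where
  "Theta_F p q r x =
     (if p = 0 then (1 + (r powr q - 1) / ln r * ln x) powr (2 / q)
      else if q = 0 then r powr (2 * (x powr p - 1) / (r powr p - 1))
      else ((r powr p - r powr q) / (r powr p - 1)
             + (r powr q - 1) / (r powr p - 1) * x powr p) powr (2 / q))"

text \<open>Theta(p,q,r) = integral over [1,r] of 1 / sqrt(F - x^2) (an integrable improper
  integral; the Henstock--Kurzweil integral covers it).\<close>
definition Theta :: "real \<Rightarrow> real \<Rightarrow> real \<Rightarrow> real" where
  "Theta p q r = integral {1..r} (\<lambda>x. 1 / sqrt (Theta_F p q r x - x\<^sup>2))"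

end

theory Submission
  imports Defs "HOL-Complex_Analysis.Conformal_Mappings" "HOL-Real_Asymp.Real_Asymp"
begin

text \<open>Write \<open>x = exp t\<close>, \<open>F = exp (2 y)\<close>, \<open>r = exp L\<close>, so that \<open>\<Theta>\<close> is the integral of
  \<open>1 / sqrt (exp (2 (y - t)) - 1)\<close> over \<open>0 \<le> t \<le> L\<close>. The gap \<open>y - t\<close> increases from \<open>0\<close> to its
  maximum \<open>h\<close> and decreases back to \<open>0\<close>. Integrating over its values \<open>h - c\<close> and substituting
  \<open>exp (2 c) = 1 + (exp (2 h) - 1) sin\<^sup>2 \<theta>\<close> turns \<open>\<Theta>\<close> into half the integral of \<open>S c\<close> over
  \<open>0 \<le> \<theta> \<le> \<pi> / 2\<close>, where the function \<open>S\<close> does not depend on \<open>h\<close>. As \<open>r\<close> and \<open>c\<close> increase with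
  \<open>h\<close>, it remains to find the sign of \<open>S'\<close>.

  With \<open>k = q - p\<close>, \<open>mu = (p + q) / k\<close>, \<open>j = 8 / k\<close>, \<open>s = k c / 4\<close> one has
  \<open>S = sqrt (1 - exp (- 2 c)) (A + B)\<close>, where \<open>A\<close> solves \<open>A' = - (A\<^sup>2 - 1) (A - mu)\<close> with
  \<open>A = \<infinity>\<close> at \<open>s = 0\<close>, and \<open>B\<close> is \<open>A\<close> for \<open>- mu\<close>. The logarithmic derivative of \<open>S\<close> is
  \<open>(k / 4) (G - Q)\<close>, where \<open>G' = - 2 G\<^sup>2 - j G\<close> and \<open>Q = - (A + B)' / (A + B)\<close> satisfies the same
  equation up to the defect \<open>P = Q' + 2 Q\<^sup>2 + j Q\<close>. Hence the sign of \<open>P\<close> decides. It is a polynomial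
  in \<open>d = A - B\<close> and \<open>n = (A + 1) (B - 1)\<close>, and \<open>d\<close> always lies between \<open>mu - 1\<close> and \<open>2 mu / 3\<close>
  (for \<open>mu \<ge> 0\<close>, where the order of the two bounds changes at \<open>mu = 3\<close>).\<close>


subsection \<open>The branch functions\<close>

text \<open>The first positive pole of \<open>phi mu\<close>, hence the right end of the range of
  \<open>1 / A\<close>.\<close>

definition wsup :: "real \<Rightarrow> real" where
  "wsup mu = (if mu > 1 then 1 / mu else 1)"

text \<open>With \<open>w = 1 / A\<close> the equation for \<open>A\<close> becomes
  \<open>w' = 1 / phi mu w\<close>, and the pole of \<open>A\<close> at time 0 becomes the finite
  starting value \<open>w = 0\<close>.\<close>

definition phi :: "real \<Rightarrow> real \<Rightarrow> real" where
  "phi mu x = x / ((1 - x\<^sup>2) * (1 - mu * x))"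

text \<open>Separation of variables: the time needed to get from 0 to \<open>w\<close>.\<close>

definition Phi :: "real \<Rightarrow> real \<Rightarrow> real" where
  "Phi mu w = integral {0..w} (phi mu)"

lemma wsup_bounds: "0 < wsup mu" "wsup mu \<le> 1"
  by (auto simp: wsup_def)

lemma one_minus_sq_pos:
  assumes "0 \<le> w" "w < wsup mu"
  shows "1 - w\<^sup>2 > 0"
proof -
  have "w < 1"
    using assms wsup_bounds(2)[of mu] by simp
  then show ?thesis
    using assms power_strict_mono[of w 1 2] by simp
qed

lemma one_minus_mu_pos:
  assumes "0 \<le> w" "w < wsup mu"
  shows "1 - mu * w > 0"
proof (cases "mu > 1")
  case True
  then show ?thesis
    using assms by (simp add: wsup_def field_simps)
next
  case False
  then have "w < 1"
    using assms by (simp add: wsup_def)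
  moreover have "mu * w \<le> 1 * w"
    using False assms by (intro mult_right_mono) auto
  ultimately show ?thesis
    by simp
qed

lemma phi_pos:
  assumes "0 < w" "w < wsup mu"
  shows "phi mu w > 0"
  using assms one_minus_sq_pos[of w mu] one_minus_mu_pos[of w mu]
  by (simp add: phi_def)

lemma continuous_on_phi: "continuous_on {0..<wsup mu} (phi mu)"
  unfolding phi_def
proof (intro continuous_intros ballI)
  fix x
  assume "x \<in> {0..<wsup mu}"
  then show "(1 - x\<^sup>2) * (1 - mu * x) \<noteq> 0"
    using one_minus_sq_pos[of x mu] one_minus_mu_pos[of x mu] by auto
qed

lemma Phi_deriv_within:
  assumes "0 \<le> w" "w \<le> u" "u < wsup mu"
  shows "(Phi mu has_real_derivative phi mu w) (at w within {0..u})"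
  unfolding Phi_def has_real_derivative_iff_has_vector_derivative
  using assms
  by (intro integral_has_vector_derivative continuous_on_subset[OF continuous_on_phi]) auto

lemma Phi_deriv:
  assumes "0 < w" "w < wsup mu"
  shows "(Phi mu has_real_derivative phi mu w) (at w)"
proof -
  define u where "u = (w + wsup mu) / 2"
  have u: "w < u" "u < wsup mu"
    using assms by (auto simp: u_def)
  have "(Phi mu has_real_derivative phi mu w) (at w within {0..u})"
    using assms u by (intro Phi_deriv_within) auto
  moreover have "at w within {0..u} = at w"
    using assms u by (intro at_within_interior) auto
  ultimately show ?thesis
    by simp
qed

lemma Phi_0 [simp]: "Phi mu 0 = 0"
  by (simp add: Phi_def)

lemma continuous_on_Phi:
  assumes "u < wsup mu"
  shows "continuous_on {0..u} (Phi mu)"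
  unfolding continuous_on_eq_continuous_within
  using assms Phi_deriv_within[of _ u mu]
  by (auto intro!: DERIV_continuous)

lemma Phi_strict_mono:
  assumes "0 \<le> v" "v < w" "w < wsup mu"
  shows "Phi mu v < Phi mu w"
proof (rule DERIV_pos_imp_increasing_open[OF assms(2)])
  show "\<exists>y. (Phi mu has_real_derivative y) (at x) \<and> 0 < y" if "v < x" "x < w" for x
    using Phi_deriv[of x mu] phi_pos[of x mu] that assms by auto
  show "continuous_on {v..w} (Phi mu)"
    using continuous_on_Phi[of w mu] assms by (auto intro: continuous_on_subset)
qed

lemma Phi_less_iff:
  assumes "0 \<le> v" "v < wsup mu" "0 \<le> w" "w < wsup mu"
  shows "Phi mu v < Phi mu w \<longleftrightarrow> v < w"
  using Phi_strict_mono[of v w mu] Phi_strict_mono[of w v mu] assms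
  by (metis less_irrefl not_less_iff_gr_or_eq order_less_asym)

lemma Phi_le_iff:
  assumes "0 \<le> v" "v < wsup mu" "0 \<le> w" "w < wsup mu"
  shows "Phi mu v \<le> Phi mu w \<longleftrightarrow> v \<le> w"
  using Phi_less_iff[of w mu v] assms by linarith

text \<open>Replaces \<open>phi mu\<close> by a smaller integrand whose primitive \<open>f\<close>
  is elementary.\<close>

lemma Phi_lower_bound_by_primitive:
  assumes w: "0 \<le> w" "w < wsup mu"
    and 0: "f 0 = 0"
    and f: "\<And>x. 0 \<le> x \<Longrightarrow> x < wsup mu \<Longrightarrow> (f has_real_derivative f' x) (at x)"
    and le: "\<And>x. 0 < x \<Longrightarrow> x < wsup mu \<Longrightarrow> f' x \<le> phi mu x"
  shows "f w \<le> Phi mu w"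
proof -
  have "Phi mu 0 - f 0 \<le> Phi mu w - f w"
  proof (rule DERIV_nonneg_imp_increasing_open[OF w(1)])
    fix x assume x: "0 < x" "x < w"
    then have "((\<lambda>x. Phi mu x - f x) has_real_derivative (phi mu x - f' x)) (at x)"
      using w by (intro derivative_intros Phi_deriv f) auto
    then show "\<exists>y. ((\<lambda>x. Phi mu x - f x) has_real_derivative y) (at x) \<and> 0 \<le> y"
      using le[of x] x w by (intro exI conjI) auto
  next
    have "continuous_on {0..w} f"
      unfolding continuous_on_eq_continuous_within using f w
      by (auto intro!: DERIV_continuous has_field_derivative_at_within[OF f])
    then show "continuous_on {0..w} (\<lambda>x. Phi mu x - f x)"
      using continuous_on_Phi[OF w(2)] by (intro continuous_intros)
  qed
  then show ?thesis
    using 0 by simp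
qed

text \<open>The time diverges at the pole. For \<open>mu > 1\<close> the factor
  \<open>1 - x^2\<close> is bounded by 1, otherwise \<open>1 - mu * x\<close> by a constant; what
  remains has a logarithmic primitive.\<close>

lemma Phi_unbounded: "\<exists>w. 0 \<le> w \<and> w < wsup mu \<and> s \<le> Phi mu w"
proof (cases "mu > 1")
  case True
  define s' where "s' = max s 0"
  \<comment> \<open>Solves \<open>- ln z / mu^2 = s' + 1 / mu\<close>; the surplus
    \<open>1 / mu\<close> absorbs the term \<open>- w / mu\<close> of the primitive.\<close>
  define z where "z = exp (- (mu\<^sup>2 * s' + mu))"
  define w where "w = (1 - z) / mu"
  have z: "0 < z" "z < 1"
    using True add_nonneg_pos[of "mu\<^sup>2 * s'" mu] by (auto simp: z_def s'_def)
  have w: "0 \<le> w" "w < wsup mu" "w \<le> 1" "1 - mu * w = z"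
    using z True by (auto simp: w_def wsup_def field_simps)
  have "- w / mu - ln (1 - mu * w) / mu\<^sup>2 \<le> Phi mu w"
  proof (rule Phi_lower_bound_by_primitive[where f' = "\<lambda>x. x / (1 - mu * x)"])
    fix x assume x: "0 \<le> x" "x < wsup mu"
    then have p: "1 - mu * x > 0"
      by (rule one_minus_mu_pos)
    have "((\<lambda>w. - w / mu - ln (1 - mu * w) / mu\<^sup>2) has_real_derivative
        - 1 / mu + mu / (1 - mu * x) / mu\<^sup>2) (at x)"
      using True p by (auto intro!: derivative_eq_intros simp: field_simps)
    moreover have "- 1 / mu + mu / (1 - mu * x) / mu\<^sup>2 = x / (1 - mu * x)"
      using True p by (simp add: field_simps power2_eq_square)
    ultimately show "((\<lambda>w. - w / mu - ln (1 - mu * w) / mu\<^sup>2) has_real_derivative x / (1 - mu * x)) (at x)"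
      by simp
  next
    fix x assume x: "0 < x" "x < wsup mu"
    then have p: "1 - mu * x > 0" "1 - x\<^sup>2 > 0"
      using one_minus_mu_pos[of x mu] one_minus_sq_pos[of x mu] by auto
    then have "(1 - x\<^sup>2) * (1 - mu * x) \<le> 1 * (1 - mu * x)"
      by (intro mult_right_mono) auto
    then show "x / (1 - mu * x) \<le> phi mu x"
      unfolding phi_def using x p by (intro divide_left_mono) auto
  qed (use w in auto)
  moreover have "s \<le> - w / mu - ln (1 - mu * w) / mu\<^sup>2"
  proof -
    have "w / mu \<le> 1 / mu"
      using w True by (intro divide_right_mono) auto
    moreover have "- ln (1 - mu * w) / mu\<^sup>2 = s' + 1 / mu"
      unfolding w z_def using True by (simp add: field_simps power2_eq_square)
    moreover have "s \<le> s'"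
      by (simp add: s'_def)
    ultimately show ?thesis
      by simp
  qed
  ultimately show ?thesis
    using w by (intro exI[of _ w]) auto
next
  case False
  \<comment> \<open>An upper bound of \<open>1 - mu * x\<close> for \<open>x\<close> between 0 and
    1.\<close>
  define K where "K = 1 + \<bar>mu\<bar>"
  define s' where "s' = max s 0"
  define z where "z = exp (- 2 * K * s')"
  define w where "w = sqrt (1 - z)"
  have K: "K \<ge> 1"
    by (simp add: K_def)
  have z: "0 < z" "z \<le> 1"
    using K by (auto simp: z_def s'_def)
  have w: "0 \<le> w" "w < wsup mu" "1 - w\<^sup>2 = z"
    using z False by (auto simp: w_def wsup_def)
  have "- ln (1 - w\<^sup>2) / (2 * K) \<le> Phi mu w"
  proof (rule Phi_lower_bound_by_primitive[where f' = "\<lambda>x. x / ((1 - x\<^sup>2) * K)"])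
    fix x assume x: "0 \<le> x" "x < wsup mu"
    then have p: "1 - x\<^sup>2 > 0"
      by (rule one_minus_sq_pos)
    have "((\<lambda>w. - ln (1 - w\<^sup>2) / (2 * K)) has_real_derivative
        2 * x / (1 - x\<^sup>2) / (2 * K)) (at x)"
      using K p by (auto intro!: derivative_eq_intros simp: field_simps)
    moreover have "2 * x / (1 - x\<^sup>2) / (2 * K) = x / ((1 - x\<^sup>2) * K)"
      using K p by (simp add: field_simps)
    ultimately show "((\<lambda>w. - ln (1 - w\<^sup>2) / (2 * K)) has_real_derivative x / ((1 - x\<^sup>2) * K)) (at x)"
      by simp
  next
    fix x assume x: "0 < x" "x < wsup mu"
    then have p: "1 - mu * x > 0" "1 - x\<^sup>2 > 0"
      using one_minus_mu_pos[of x mu] one_minus_sq_pos[of x mu] by auto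
    have "- mu * x \<le> \<bar>mu\<bar> * 1"
      using x wsup_bounds(2)[of mu] by (intro mult_mono) auto
    then have "(1 - x\<^sup>2) * (1 - mu * x) \<le> (1 - x\<^sup>2) * K"
      using p by (intro mult_left_mono) (auto simp: K_def)
    then show "x / ((1 - x\<^sup>2) * K) \<le> phi mu x"
      unfolding phi_def using x p K by (intro divide_left_mono) auto
  qed (use w in auto)
  moreover have "- ln (1 - w\<^sup>2) / (2 * K) = s'"
    unfolding w z_def using K by simp
  moreover have "s \<le> s'"
    by (simp add: s'_def)
  ultimately show ?thesis
    using w by (intro exI[of _ w]) auto
qed

lemma Phi_surj:
  assumes "0 \<le> s"
  shows "\<exists>w. 0 \<le> w \<and> w < wsup mu \<and> Phi mu w = s"
proof -
  obtain u where u: "0 \<le> u" "u < wsup mu" "s \<le> Phi mu u"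
    using Phi_unbounded by blast
  then have "\<exists>w\<ge>0. w \<le> u \<and> Phi mu w = s"
    using assms continuous_on_Phi by (intro IVT') auto
  then show ?thesis
    using u by fastforce
qed

section \<open>Inversion of the time function and the solution that blows up at time 0\<close>

definition W :: "real \<Rightarrow> real \<Rightarrow> real" where
  "W mu s = (THE w. 0 \<le> w \<and> w < wsup mu \<and> Phi mu w = s)"

lemma W_eqI:
  assumes "0 \<le> w" "w < wsup mu" "Phi mu w = s"
  shows "W mu s = w"
  unfolding W_def
proof (rule the_equality)
  show "w' = w" if "0 \<le> w' \<and> w' < wsup mu \<and> Phi mu w' = s" for w'
    using that assms Phi_less_iff[of w mu w'] Phi_less_iff[of w' mu w] by auto
qed (use assms in auto)

lemma W_props:
  assumes "0 \<le> s"
  shows "0 \<le> W mu s" "W mu s < wsup mu" "Phi mu (W mu s) = s"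
  using Phi_surj[OF assms, of mu] W_eqI[of _ mu s] by auto

lemma W_0 [simp]: "W mu 0 = 0"
  by (rule W_eqI) (auto simp: wsup_bounds)

lemma W_pos:
  assumes "0 < s"
  shows "0 < W mu s"
  using W_props[of s mu] assms by (metis Phi_0 less_eq_real_def)

lemma W_deriv:
  assumes "0 < s"
  shows "(W mu has_real_derivative (1 - (W mu s)\<^sup>2) * (1 - mu * W mu s) / W mu s) (at s)"
proof -
  have w: "0 < W mu s" "W mu s < wsup mu" "Phi mu (W mu s) = s"
    using W_pos[OF assms] W_props[of s mu] assms by auto
  have "(W mu has_real_derivative inverse (phi mu (W mu s))) (at (Phi mu (W mu s)))"
  proof (rule has_field_derivative_inverse_strong[where f = "Phi mu" and x = "W mu s" and S = "{0<..<wsup mu}"])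
    show "continuous_on {0<..<wsup mu} (Phi mu)"
      unfolding continuous_on_eq_continuous_within
      by (auto intro!: DERIV_continuous has_field_derivative_at_within[OF Phi_deriv])
  qed (use w Phi_deriv[of "W mu s" mu] phi_pos[of "W mu s" mu] in \<open>auto intro!: W_eqI\<close>)
  then show ?thesis
    using w by (simp add: phi_def)
qed

text \<open>At 0 the slope of \<open>W mu\<close> is infinite, so continuity there comes from
  monotonicity: \<open>W mu s < u\<close> as soon as \<open>s < Phi mu u\<close>.\<close>

lemma continuous_on_W: "continuous_on {0..} (W mu)"
  unfolding continuous_on_eq_continuous_within
proof
  fix s :: real
  assume "s \<in> {0..}"
  then consider "s = 0" | "s > 0"
    by fastforce
  then show "continuous (at s within {0..}) (W mu)"
  proof cases
    case 2
    then show ?thesis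
      by (intro DERIV_continuous[OF has_field_derivative_at_within[OF W_deriv]])
  next
    case 1
    have "(W mu \<longlongrightarrow> 0) (at 0 within {0..})"
    proof (rule tendstoI)
      fix e :: real
      assume e: "e > 0"
      define u where "u = min e (wsup mu / 2)"
      have u: "0 < u" "u < wsup mu" "u \<le> e"
        using e wsup_bounds[of mu] by (auto simp: u_def)
      have pos: "Phi mu u > 0"
        using Phi_strict_mono[of 0 u mu] u by simp
      show "\<forall>\<^sub>F s in at 0 within {0..}. dist (W mu s) 0 < e"
        unfolding eventually_at
      proof (intro exI conjI ballI impI)
        fix s :: real
        assume s: "s \<in> {0..}" "s \<noteq> 0 \<and> dist s 0 < Phi mu u"
        then have "W mu s < u"
          using W_props[of s mu] u Phi_less_iff[of "W mu s" mu u] by auto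
        then show "dist (W mu s) 0 < e"
          using u W_props(1)[of s mu] s by auto
      qed (rule pos)
    qed
    then show ?thesis
      using 1 by (simp add: continuous_within)
  qed
qed

definition A :: "real \<Rightarrow> real \<Rightarrow> real" where
  "A mu s = 1 / W mu s"

text \<open>The inverse hyperbolic cotangent of \<open>A mu\<close>, and also the primitive of
  \<open>A mu - mu\<close> vanishing at 0. The positions on the branches are expressed through
  it.\<close>

definition a :: "real \<Rightarrow> real \<Rightarrow> real" where
  "a mu s = artanh (W mu s)"

lemma A_gt:
  assumes "0 < s"
  shows "A mu s > 1" "A mu s > mu"
proof -
  have w: "0 < W mu s" "W mu s < 1" "1 - mu * W mu s > 0"
    using assms W_props[of s mu] W_pos[of s mu] wsup_bounds[of mu] one_minus_mu_pos[of "W mu s" mu]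
    by auto
  then show "A mu s > 1" "A mu s > mu"
    by (auto simp: A_def field_simps)
qed

lemma A_deriv:
  assumes "0 < s"
  shows "(A mu has_real_derivative - ((A mu s)\<^sup>2 - 1) * (A mu s - mu)) (at s)"
proof -
  have w: "0 < W mu s"
    using W_pos[OF assms] .
  have "(A mu has_real_derivative
      - ((1 - (W mu s)\<^sup>2) * (1 - mu * W mu s) / W mu s) / (W mu s)\<^sup>2) (at s)"
    unfolding A_def using w
    by (auto intro!: derivative_eq_intros W_deriv[OF assms] simp: power2_eq_square field_simps)
  moreover have "- ((1 - (W mu s)\<^sup>2) * (1 - mu * W mu s) / W mu s) / (W mu s)\<^sup>2 =
      - ((A mu s)\<^sup>2 - 1) * (A mu s - mu)"
    unfolding A_def using w by (simp add: field_simps power2_eq_square)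
  ultimately show ?thesis
    by simp
qed

lemma a_0 [simp]: "a mu 0 = 0"
  by (simp add: a_def)

lemma a_deriv:
  assumes "0 < s"
  shows "(a mu has_real_derivative A mu s - mu) (at s)"
proof -
  have w: "0 < W mu s" "W mu s < 1" "1 - (W mu s)\<^sup>2 > 0"
    using assms W_props[of s mu] W_pos[of s mu] wsup_bounds[of mu] one_minus_sq_pos[of "W mu s" mu]
    by auto
  have "(a mu has_real_derivative
      1 / (1 - (W mu s)\<^sup>2) * ((1 - (W mu s)\<^sup>2) * (1 - mu * W mu s) / W mu s)) (at s)"
    unfolding a_def using w
    by (intro DERIV_chain2[OF artanh_real_has_field_derivative W_deriv[OF assms]]) auto
  moreover have "1 / (1 - (W mu s)\<^sup>2) * ((1 - (W mu s)\<^sup>2) * (1 - mu * W mu s) / W mu s) = A mu s - mu"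
    unfolding A_def using w by (simp add: field_simps)
  ultimately show ?thesis
    by simp
qed

lemma continuous_on_a: "continuous_on {0..} (a mu)"
  unfolding a_def
proof (rule continuous_on_compose2[OF _ continuous_on_W])
  show "continuous_on {-1<..<1::real} artanh"
    by (intro continuous_intros) auto
  show "W mu ` {0..} \<subseteq> {-1<..<1}"
    using W_props[of _ mu] wsup_bounds(2)[of mu] by (force intro: less_le_trans)
qed

lemma exp_2a:
  assumes "0 < s"
  shows "exp (2 * a mu s) * (A mu s - 1) = A mu s + 1"
proof -
  have w: "0 < W mu s" "W mu s < 1"
    using assms W_props[of s mu] W_pos[of s mu] wsup_bounds[of mu] by auto
  then have "exp (2 * a mu s) = (1 + W mu s) / (1 - W mu s)"
    by (simp add: a_def artanh_def)
  then show ?thesis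
    using w by (simp add: A_def field_simps)
qed

text \<open>The derivative of \<open>(W mu s)^2\<close> tends to 2, so \<open>(W mu s)^2\<close>
  behaves like \<open>2 * s\<close>. This leading order is the same for all
  \<open>mu\<close>.\<close>

lemma s_A_sq_tendsto: "((\<lambda>s. s * (A mu s)\<^sup>2) \<longlongrightarrow> 1 / 2) (at_right 0)"
proof -
  have W0: "(W mu \<longlongrightarrow> 0) (at_right 0)"
    using continuous_on_W[of mu]
    by (auto simp: continuous_on_def intro: tendsto_within_subset dest!: bspec[of _ _ 0])
  have "((\<lambda>s. s / (W mu s)\<^sup>2) \<longlongrightarrow> 1 / 2) (at_right 0)"
  proof (rule lhopital_right_0[where f' = "\<lambda>_. 1" and
        g' = "\<lambda>s. 2 * ((1 - (W mu s)\<^sup>2) * (1 - mu * W mu s))"])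
    show "((\<lambda>s. (W mu s)\<^sup>2) \<longlongrightarrow> 0) (at_right 0)"
      using tendsto_power[OF W0, of 2] by simp
    show "\<forall>\<^sub>F s in at_right 0. (W mu s)\<^sup>2 \<noteq> 0"
      using eventually_at_right_less[of 0]
      by eventually_elim (metis W_pos less_irrefl power_not_zero)
    show "\<forall>\<^sub>F s in at_right 0. 2 * ((1 - (W mu s)\<^sup>2) * (1 - mu * W mu s)) \<noteq> 0"
      using eventually_at_right_less[of 0]
    proof eventually_elim
      case (elim s)
      then show ?case
        using W_props[of s mu] one_minus_mu_pos[of "W mu s" mu] one_minus_sq_pos[of "W mu s" mu]
        by auto
    qed
    show "\<forall>\<^sub>F s in at_right 0. ((\<lambda>s. s) has_real_derivative 1) (at s)"
      by simp
    show "\<forall>\<^sub>F s in at_right 0. ((\<lambda>s. (W mu s)\<^sup>2) has_real_derivative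
        2 * ((1 - (W mu s)\<^sup>2) * (1 - mu * W mu s))) (at s)"
      using eventually_at_right_less[of 0]
    proof eventually_elim
      case (elim s)
      then show ?case
        using W_pos[OF elim, of mu] by (auto intro!: derivative_eq_intros W_deriv)
    qed
    have "((\<lambda>s. 1 / (2 * ((1 - (W mu s)\<^sup>2) * (1 - mu * W mu s)))) \<longlongrightarrow>
        1 / (2 * ((1 - 0\<^sup>2) * (1 - mu * 0)))) (at_right 0)"
      by (intro tendsto_intros W0) auto
    then show "((\<lambda>s. 1 / (2 * ((1 - (W mu s)\<^sup>2) * (1 - mu * W mu s)))) \<longlongrightarrow> 1 / 2) (at_right 0)"
      by simp
  qed (auto intro: tendsto_ident_at)
  then show ?thesis
    by (simp add: A_def power_divide)
qed

subsection \<open>The gap between the two branches\<close>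

lemma nonneg_if_decreasing_to_0:
  fixes f f' :: "real \<Rightarrow> real"
  assumes "\<And>y. y \<ge> x \<Longrightarrow> (f has_real_derivative f' y) (at y)" "\<And>y. y \<ge> x \<Longrightarrow> f' y \<le> 0"
    and lim: "(f \<longlongrightarrow> 0) at_top"
  shows "f x \<ge> 0"
proof (rule tendsto_upperbound[OF lim])
  show "\<forall>\<^sub>F y in at_top. f y \<le> f x"
    using eventually_ge_at_top[of x]
  proof eventually_elim
    case (elim y)
    then show ?case
      using assms(1,2) by (intro DERIV_nonpos_imp_nonincreasing[of x y f]) blast+
  qed
qed simp

lemma pos_if_increasing_from_0:
  fixes f f' :: "real \<Rightarrow> real"
  assumes "\<And>y. y > 0 \<Longrightarrow> (f has_real_derivative f' y) (at y)" "\<And>y. y > 0 \<Longrightarrow> f' y > 0"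
    and lim: "(f \<longlongrightarrow> 0) (at_right 0)"
    and x: "x > 0"
  shows "f x > 0"
proof -
  have mono: "f y < f z" if "0 < y" "y < z" for y z
    using that assms(1,2) by (intro DERIV_pos_imp_increasing[of y z f]) (meson less_le_trans)+
  have "\<forall>\<^sub>F y in at_right 0. f y \<le> f (x / 2)"
    using eventually_at_right_real[of 0 "x / 2"] x
    by (auto elim!: eventually_mono intro!: less_imp_le mono)
  then have "f (x / 2) \<ge> 0"
    by (intro tendsto_upperbound[OF lim]) auto
  then show ?thesis
    using mono[of "x / 2" x] x by simp
qed

lemma inverse_less_wsup_iff:
  assumes "x > 0"
  shows "1 / x < wsup mu \<longleftrightarrow> x > 1 \<and> x > mu"
  using assms by (auto simp: wsup_def field_simps)

text \<open>\<open>Phi mu (1 / x)\<close> is the time at which \<open>A mu\<close> takes the value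
  \<open>x\<close>, so its derivative is the reciprocal of the cubic speed.\<close>

lemma Phi_recip_deriv:
  assumes "x > 1" "x > mu"
  shows "((\<lambda>x. Phi mu (1 / x)) has_real_derivative - (1 / ((x\<^sup>2 - 1) * (x - mu)))) (at x)"
proof -
  have x2: "x\<^sup>2 > 1"
    using assms by simp
  have "((\<lambda>x. Phi mu (1 / x)) has_real_derivative phi mu (1 / x) * (- 1 / x\<^sup>2)) (at x)"
    using assms inverse_less_wsup_iff[of x mu]
    by (intro DERIV_chain2[OF Phi_deriv]) (auto intro!: derivative_eq_intros simp: power2_eq_square)
  moreover have "phi mu (1 / x) * (- 1 / x\<^sup>2) = - (1 / ((x\<^sup>2 - 1) * (x - mu)))"
    using assms x2 by (simp add: phi_def field_simps power2_eq_square)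
  ultimately show ?thesis
    by simp
qed

lemma Phi_recip_at_top: "((\<lambda>x. Phi mu (1 / (x - nu))) \<longlongrightarrow> 0) at_top"
proof -
  define u where "u = wsup mu / 2"
  have u: "0 < u" "u < wsup mu"
    using wsup_bounds(1)[of mu] by (auto simp: u_def)
  have "continuous (at 0 within {0..u}) (Phi mu)"
    using continuous_on_Phi[OF u(2)] u by (auto simp: continuous_on_eq_continuous_within)
  then have "(Phi mu \<longlongrightarrow> 0) (at 0 within {0..u})"
    by (simp add: continuous_within)
  moreover have "filterlim (\<lambda>x. 1 / (x - nu)) (at 0 within {0..u}) at_top"
    unfolding filterlim_at
  proof
    show "((\<lambda>x. 1 / (x - nu)) \<longlongrightarrow> 0) at_top"
      by real_asymp
    show "\<forall>\<^sub>F x in at_top. 1 / (x - nu) \<in> {0..u} \<and> 1 / (x - nu) \<noteq> 0"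
      using eventually_gt_at_top[of "nu + 1 / u"]
    proof eventually_elim
      case (elim x)
      then have *: "x - nu > 1 / u" "1 / u > 0"
        using u by auto
      then have pos: "x - nu > 0"
        by linarith
      then have "1 / (x - nu) < 1 / (1 / u)"
        using * pos by (intro divide_strict_left_mono mult_pos_pos) auto
      then show ?case
        using u pos by auto
    qed
  qed
  ultimately show ?thesis
    by (rule filterlim_compose)
qed

lemma Phi_recip_A:
  assumes "s > 0"
  shows "Phi mu (1 / A mu s) = s"
  using assms W_props[of s mu] by (simp add: A_def)

lemma Phi_recip_le_iff:
  assumes "x > 1" "x > mu" "y > 1" "y > mu"
  shows "Phi mu (1 / x) \<le> Phi mu (1 / y) \<longleftrightarrow> y \<le> x"
  using assms Phi_le_iff[of "1 / x" mu "1 / y"] inverse_less_wsup_iff[of x mu]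
    inverse_less_wsup_iff[of y mu]
  by (simp add: field_simps)

text \<open>In terms of \<open>x = 1 / w\<close> both branches solve autonomous equations with cubic
  right-hand sides, and the gap is compared with \<open>nu\<close> through the difference of these cubics.\<close>

definition cubic_diff :: "real \<Rightarrow> real \<Rightarrow> real \<Rightarrow> real" where
  "cubic_diff mu nu x = (x\<^sup>2 - 1) * (x - mu) - ((x - nu)\<^sup>2 - 1) * (x - nu + mu)"

text \<open>The function \<open>D\<close> in the proof compares the times at which
  \<open>A mu\<close> reaches \<open>x\<close> and \<open>A (- mu)\<close> reaches
  \<open>x - nu\<close>. It vanishes at infinity and its derivative has the sign of
  \<open>cubic_diff mu nu\<close>, which determines the sign of \<open>D\<close> at
  \<open>x = A mu s\<close>. The condition \<open>A mu s - nu > 1\<close> keeps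
  \<open>x - nu\<close> in the admissible range from there on.\<close>

lemma
  assumes s: "s > 0" and mu: "mu \<ge> 0" and nu: "nu \<ge> 0" "A mu s - nu > 1"
  shows gap_ge: "(\<And>x. x > mu \<Longrightarrow> x > 1 \<Longrightarrow> cubic_diff mu nu x \<le> 0) \<Longrightarrow> A mu s - A (- mu) s \<ge> nu"
    and gap_le: "(\<And>x. x > mu \<Longrightarrow> x > 1 \<Longrightarrow> cubic_diff mu nu x \<ge> 0) \<Longrightarrow> A mu s - A (- mu) s \<le> nu"
proof -
  define X where "X = A mu s"
  define f where "f = (\<lambda>x::real. (x\<^sup>2 - 1) * (x - mu))"
  define g where "g = (\<lambda>x::real. ((x - nu)\<^sup>2 - 1) * (x - nu + mu))"
  define D where "D = (\<lambda>x. Phi mu (1 / x) - Phi (- mu) (1 / (x - nu)))"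
  have X: "X > 1" "X > mu" "X - nu > 1"
    using A_gt[OF s] nu by (auto simp: X_def)
  have f: "f x > 0" and g: "g x > 0" if "x \<ge> X" for x
  proof -
    have "x\<^sup>2 > 1" "(x - nu)\<^sup>2 > 1"
      using X that nu by auto
    then show "f x > 0" "g x > 0"
      using X that mu nu by (auto simp: f_def g_def intro!: mult_pos_pos)
  qed
  have "((\<lambda>x. Phi (- mu) (1 / (x - nu))) has_real_derivative - (1 / g x)) (at x)" if "x \<ge> X" for x
  proof -
    have "((\<lambda>x. Phi (- mu) (1 / (x - nu))) has_real_derivative
        - (1 / (((x - nu)\<^sup>2 - 1) * (x - nu - - mu))) * 1) (at x)"
      using X that mu nu
      by (intro DERIV_chain2[where f = "\<lambda>y. Phi (- mu) (1 / y)"] Phi_recip_deriv)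
        (auto intro!: derivative_eq_intros)
    then show ?thesis
      by (simp add: g_def)
  qed
  then have deriv: "(D has_real_derivative (- (1 / f x) + 1 / g x)) (at x)" if "x \<ge> X" for x
    unfolding D_def using X that
    by (auto intro!: derivative_eq_intros Phi_recip_deriv simp: f_def)
  have lim: "(D \<longlongrightarrow> 0) at_top"
    using tendsto_diff[OF Phi_recip_at_top[of mu 0] Phi_recip_at_top[of "- mu" nu]]
    by (simp add: D_def)
  \<comment> \<open>\<open>A mu\<close> is at \<open>X\<close> and \<open>A (- mu)\<close> is at
    \<open>A (- mu) s\<close> at the same time \<open>s\<close>, so both times can be measured with
    \<open>Phi (- mu)\<close>.\<close>
  have DX: "D X = Phi (- mu) (1 / A (- mu) s) - Phi (- mu) (1 / (X - nu))"
    using Phi_recip_A[OF s, of mu] Phi_recip_A[OF s, of "- mu"] by (simp add: D_def X_def)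
  note iff = Phi_recip_le_iff[of "X - nu" "- mu" "A (- mu) s"]
    Phi_recip_le_iff[of "A (- mu) s" "- mu" "X - nu"]
  {
    assume *: "\<And>x. x > mu \<Longrightarrow> x > 1 \<Longrightarrow> cubic_diff mu nu x \<le> 0"
    have "D X \<ge> 0"
    proof (rule nonneg_if_decreasing_to_0[OF deriv _ lim])
      fix x assume x: "x \<ge> X"
      then have "f x \<le> g x"
        using *[of x] X by (simp add: f_def g_def cubic_diff_def)
      then show "- (1 / f x) + 1 / g x \<le> 0"
        using f[OF x] g[OF x] by (simp add: field_simps)
    qed
    then show "A mu s - A (- mu) s \<ge> nu"
      using iff A_gt[OF s, of "- mu"] X mu unfolding DX unfolding X_def by simp
  next
    assume *: "\<And>x. x > mu \<Longrightarrow> x > 1 \<Longrightarrow> cubic_diff mu nu x \<ge> 0"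
    have "- D X \<ge> 0"
    proof (rule nonneg_if_decreasing_to_0[where f = "\<lambda>x. - D x" and f' = "\<lambda>x. 1 / f x - 1 / g x"])
      show "((\<lambda>x. - D x) \<longlongrightarrow> 0) at_top"
        using tendsto_minus[OF lim] by simp
      fix x assume x: "x \<ge> X"
      show "((\<lambda>x. - D x) has_real_derivative 1 / f x - 1 / g x) (at x)"
        using DERIV_minus[OF deriv[OF x]] by simp
      have "g x \<le> f x"
        using *[of x] X x by (simp add: f_def g_def cubic_diff_def)
      then show "1 / f x - 1 / g x \<le> 0"
        using f[OF x] g[OF x] by (simp add: field_simps)
    qed
    then show "A mu s - A (- mu) s \<le> nu"
      using iff A_gt[OF s, of "- mu"] X mu unfolding DX unfolding X_def by simp
  }
qed

text \<open>A larger \<open>mu\<close> makes the time integrand larger, so \<open>W\<close> advances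
  more slowly and its reciprocal stays larger.\<close>

lemma gap_pos:
  assumes "s > 0" "mu > 0"
  shows "A mu s - A (- mu) s > 0"
proof -
  have w: "0 < W mu s" "W mu s < wsup mu" "Phi mu (W mu s) = s"
    using assms W_props[of s mu] W_pos[of s mu] by auto
  have le: "wsup mu \<le> wsup (- mu)"
    using assms by (auto simp: wsup_def)
  have "Phi mu 0 - Phi (- mu) 0 < Phi mu (W mu s) - Phi (- mu) (W mu s)"
  proof (rule DERIV_pos_imp_increasing_open[OF w(1)])
    fix x assume x: "0 < x" "x < W mu s"
    have p: "1 - mu * x > 0" "1 - x\<^sup>2 > 0"
      using x w one_minus_mu_pos[of x mu] one_minus_sq_pos[of x mu] by auto
    have mx: "mu * x > 0"
      using x assms by simp
    have "phi mu x > phi (- mu) x"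
      unfolding phi_def using p mx x
      by (intro divide_strict_left_mono mult_strict_left_mono mult_pos_pos) auto
    moreover have "((\<lambda>x. Phi mu x - Phi (- mu) x) has_real_derivative phi mu x - phi (- mu) x) (at x)"
      using x w le by (intro derivative_intros Phi_deriv) auto
    ultimately show "\<exists>y. ((\<lambda>x. Phi mu x - Phi (- mu) x) has_real_derivative y) (at x) \<and> 0 < y"
      by (intro exI conjI) auto
  next
    show "continuous_on {0..W mu s} (\<lambda>x. Phi mu x - Phi (- mu) x)"
      using w le by (intro continuous_intros continuous_on_Phi) auto
  qed
  then have "Phi (- mu) (W mu s) < Phi (- mu) (W (- mu) s)"
    using w W_props(3)[of s "- mu"] assms by simp
  then have "W mu s < W (- mu) s"
    using Phi_less_iff[of "W mu s" "- mu" "W (- mu) s"] w le W_props[of s "- mu"] assms by auto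
  then show ?thesis
    using w by (simp add: A_def field_simps)
qed

text \<open>For \<open>nu = 2 * mu / 3\<close> the quadratic and linear terms of
  \<open>cubic_diff\<close> cancel and a constant remains; for \<open>nu = mu - 1\<close> the two
  cubics share the roots \<open>mu\<close> and \<open>-1\<close>. Both differences change sign at
  \<open>mu = 3\<close>.\<close>

lemma gap_bounds_small:
  assumes s: "s > 0" and mu: "0 \<le> mu" "mu \<le> 3"
  shows "A mu s - A (- mu) s \<le> 2 * mu / 3" "mu - 1 \<le> A mu s - A (- mu) s"
proof -
  have ge0: "A mu s - A (- mu) s \<ge> 0"
    using gap_pos[OF s, of mu] mu by (cases "mu = 0") auto
  show "A mu s - A (- mu) s \<le> 2 * mu / 3"
  proof (cases "A mu s - 2 * mu / 3 > 1")
    case True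
    show ?thesis
    proof (rule gap_le[OF s mu(1) _ True])
      fix x
      have "cubic_diff mu (2 * mu / 3) x = 4 * mu / 27 * ((3 - mu) * (3 + mu))"
        by (simp add: cubic_diff_def power2_eq_square field_simps)
      moreover have "4 * mu / 27 * ((3 - mu) * (3 + mu)) \<ge> 0"
        using mu by (intro mult_nonneg_nonneg) auto
      ultimately show "cubic_diff mu (2 * mu / 3) x \<ge> 0"
        by linarith
    qed (use mu in auto)
  next
    case False
    then show ?thesis
      using A_gt(1)[OF s, of "- mu"] by linarith
  qed
  show "mu - 1 \<le> A mu s - A (- mu) s"
  proof (cases "mu \<ge> 1")
    case True
    show ?thesis
    proof (rule gap_ge[OF s mu(1)])
      fix x assume x: "x > mu" "x > 1"
      have "cubic_diff mu (mu - 1) x = - ((3 - mu) * ((x - mu) * (x + 1)))"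
        by (simp add: cubic_diff_def power2_eq_square field_simps)
      moreover have "(3 - mu) * ((x - mu) * (x + 1)) \<ge> 0"
        using mu x by simp
      ultimately show "cubic_diff mu (mu - 1) x \<le> 0"
        by linarith
    qed (use True A_gt[OF s, of mu] in auto)
  next
    case False
    then show ?thesis
      using ge0 by simp
  qed
qed

text \<open>The same two comparisons with reversed signs. Since \<open>A mu s > mu \<ge> 3\<close>,
  both shifts leave a value above 1.\<close>

lemma gap_bounds_large:
  assumes s: "s > 0" and mu: "mu \<ge> 3"
  shows "2 * mu / 3 \<le> A mu s - A (- mu) s" "A mu s - A (- mu) s \<le> mu - 1"
proof -
  note A = A_gt[OF s, of mu]
  show "2 * mu / 3 \<le> A mu s - A (- mu) s"
  proof (rule gap_ge[OF s])
    fix x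
    have "cubic_diff mu (2 * mu / 3) x = - (4 * mu / 27 * ((mu - 3) * (3 + mu)))"
      by (simp add: cubic_diff_def power2_eq_square field_simps)
    moreover have "4 * mu / 27 * ((mu - 3) * (3 + mu)) \<ge> 0"
      using mu by (intro mult_nonneg_nonneg) auto
    ultimately show "cubic_diff mu (2 * mu / 3) x \<le> 0"
      by linarith
  qed (use mu A in auto)
  show "A mu s - A (- mu) s \<le> mu - 1"
  proof (rule gap_le[OF s])
    fix x assume x: "x > mu" "x > 1"
    have "cubic_diff mu (mu - 1) x = (mu - 3) * ((x - mu) * (x + 1))"
      by (simp add: cubic_diff_def power2_eq_square field_simps)
    then show "cubic_diff mu (mu - 1) x \<ge> 0"
      using mu x by simp
  qed (use mu A in auto)
qed

subsection \<open>Sign of the Riccati defect\<close>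

text \<open>\<open>Q' + 2 * Q^2 + j * Q\<close> written in terms of \<open>d\<close> and
  \<open>n\<close>. It is affine in \<open>n\<close>, and its coefficient of \<open>j\<close>, which
  is \<open>n + d * (d + 1 - m)\<close>, equals \<open>Q\<close>.\<close>

definition defect :: "real \<Rightarrow> real \<Rightarrow> real \<Rightarrow> real \<Rightarrow> real" where
  "defect m j d n = - n * (3 * d\<^sup>2 - 4 * m * d + 2 * m\<^sup>2 + 2 - j)
     + d * (d + 1 - m) * (j - (3 + m) * d + 2 * (m - 1))"

text \<open>A convex function lies below its chord. The value at \<open>l\<close> may be 0 as long
  as \<open>x\<close> is not \<open>l\<close>, because then the right end has positive
  weight.\<close>

lemma convex_quadratic_less_0:
  fixes a b c l u x :: real
  assumes "a \<ge> 0" "l \<le> x" "x \<le> u"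
    and "a * l\<^sup>2 + b * l + c \<le> 0" "a * u\<^sup>2 + b * u + c < 0"
    and l: "x = l \<Longrightarrow> a * l\<^sup>2 + b * l + c < 0"
  shows "a * x\<^sup>2 + b * x + c < 0"
proof (cases "x = l")
  case True
  then show ?thesis
    using l by simp
next
  case False
  have "(u - l) * (a * x\<^sup>2 + b * x + c) =
      (u - x) * (a * l\<^sup>2 + b * l + c) + (x - l) * (a * u\<^sup>2 + b * u + c) - a * ((u - x) * ((x - l) * (u - l)))"
    by (simp add: power2_eq_square algebra_simps)
  moreover have "(u - x) * (a * l\<^sup>2 + b * l + c) \<le> 0" "(x - l) * (a * u\<^sup>2 + b * u + c) < 0"
    using assms False by (auto intro!: mult_nonneg_nonpos mult_pos_neg)
  moreover have "a * ((u - x) * ((x - l) * (u - l))) \<ge> 0"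
    using assms by (intro mult_nonneg_nonneg) auto
  ultimately have "(u - l) * (a * x\<^sup>2 + b * x + c) < 0"
    by linarith
  then show ?thesis
    using assms False by (simp add: mult_less_0_iff)
qed

text \<open>Both summands have the right sign: completing the square at \<open>d = 2 * m / 3\<close>
  shows that the factor of \<open>- n\<close> is positive, and the last bracket is at most
  0.\<close>

lemma defect_neg_below_1:
  assumes "0 \<le> m" "m < 1" "j \<le> 2 * (1 - m)" "(m, j) \<noteq> (0, 2)" "d \<ge> 0" "m = 0 \<Longrightarrow> d = 0" "n > 0"
  shows "defect m j d n < 0"
proof -
  have X: "3 * d\<^sup>2 - 4 * m * d + 2 * m\<^sup>2 + 2 - j > 0"
  proof -
    have "3 * d\<^sup>2 - 4 * m * d + 2 * m\<^sup>2 = 3 * (d - 2 * m / 3)\<^sup>2 + 2 * m\<^sup>2 / 3"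
      by (simp add: power2_eq_square field_simps)
    moreover have "3 * (d - 2 * m / 3)\<^sup>2 \<ge> 0" "2 * m\<^sup>2 / 3 \<ge> 0"
      by auto
    moreover have "2 - j \<ge> 2 * m" "m = 0 \<Longrightarrow> j < 2"
      using assms by auto
    moreover have "m = 0 \<Longrightarrow> d = 0"
      using assms by simp
    ultimately show ?thesis
      using assms(1) by (cases "m = 0") (simp, linarith)
  qed
  have "(3 + m) * d \<ge> 0"
    using assms by simp
  moreover have "j + 2 * (m - 1) \<le> 0"
    using assms(3) by (simp add: algebra_simps)
  ultimately have "j - (3 + m) * d + 2 * (m - 1) \<le> 0"
    by linarith
  then have "d * (d + 1 - m) * (j - (3 + m) * d + 2 * (m - 1)) \<le> 0"
    using assms by (intro mult_nonneg_nonpos mult_nonneg_nonneg) auto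
  then show ?thesis
    using mult_pos_pos[OF \<open>n > 0\<close> X] by (simp add: defect_def)
qed

text \<open>Again both summands have the right sign. The bound \<open>m^2 - 1\<close> on
  \<open>j\<close> is the value at which the last bracket vanishes for the smallest gap
  \<open>d = m - 1\<close>.\<close>

lemma defect_neg_1_to_3:
  assumes "1 < m" "m \<le> 3" "j \<le> m\<^sup>2 - 1" "(m, j) \<noteq> (3, 8)" "m - 1 \<le> d" "d \<le> 2 * m / 3" "n > 0"
  shows "defect m j d n < 0"
proof -
  have X: "3 * d\<^sup>2 - 4 * m * d + 2 * m\<^sup>2 + 2 - j > 0"
  proof (cases "m = 3")
    case True
    then have "d = 2" "j < 8"
      using assms by auto
    then show ?thesis
      using True by simp
  next
    case False
    have "3 * d\<^sup>2 - 4 * m * d + m\<^sup>2 + 3 = 3 * (d - 2 * m / 3)\<^sup>2 + (3 - m) * (3 + m) / 3"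
      by (simp add: power2_eq_square field_simps)
    moreover have "(3 - m) * (3 + m) / 3 > 0" "3 * (d - 2 * m / 3)\<^sup>2 \<ge> 0"
      using assms False by auto
    ultimately show ?thesis
      using assms(3) by linarith
  qed
  have "(3 + m) * (m - 1) \<le> (3 + m) * d"
    using assms by (intro mult_left_mono) auto
  moreover have "m\<^sup>2 - 1 - (3 + m) * (m - 1) + 2 * (m - 1) = 0"
    by (simp add: power2_eq_square algebra_simps)
  ultimately have "j - (3 + m) * d + 2 * (m - 1) \<le> 0"
    using assms(3) by linarith
  then have "d * (d + 1 - m) * (j - (3 + m) * d + 2 * (m - 1)) \<le> 0"
    using assms by (intro mult_nonneg_nonpos mult_nonneg_nonneg) auto
  then show ?thesis
    using mult_pos_pos[OF \<open>n > 0\<close> X] by (simp add: defect_def)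
qed

text \<open>Now \<open>d + 1 - m\<close> is at most 0, so the second summand can have the wrong
  sign. The lower bound on \<open>n\<close> lets the first one absorb it, and the sign of
  \<open>(m + 1) * X + d * Y\<close> decides.\<close>

lemma defect_neg_above_3:
  assumes "3 < m" "j \<le> 2 * (m + 1)" "2 * m / 3 \<le> d" "d \<le> m - 1"
    and n: "n > 0" "n \<ge> (m + 1) * (m - 1 - d)"
  shows "defect m j d n < 0"
proof -
  define e where "e = m - 1 - d"
  define X where "X = 3 * d\<^sup>2 - 4 * m * d + 2 * m\<^sup>2 + 2 - j"
  define Y where "Y = j - (3 + m) * d + 2 * (m - 1)"
  have e: "e \<ge> 0"
    using assms by (simp add: e_def)
  have X: "X > 0"
  proof -
    have "3 * d\<^sup>2 - 4 * m * d + 2 * m\<^sup>2 + 2 - 2 * (m + 1) = 3 * (d - 2 * m / 3)\<^sup>2 + 2 * m / 3 * (m - 3)"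
      by (simp add: power2_eq_square field_simps)
    moreover have "3 * (d - 2 * m / 3)\<^sup>2 \<ge> 0" "2 * m / 3 * (m - 3) > 0"
      using assms by auto
    ultimately show ?thesis
      unfolding X_def using assms(2) by linarith
  qed
  have P: "defect m j d n = - n * X - e * (d * Y)"
    by (simp add: defect_def X_def Y_def e_def algebra_simps)
  show ?thesis
  proof (cases "e = 0")
    case True
    then show ?thesis
      unfolding P using mult_pos_pos[OF n(1) X] by simp
  next
    case False
    \<comment> \<open>The two products vanish at the extreme values \<open>j = 2 * (m + 1)\<close>
      and \<open>d = m - 1\<close> of the hypotheses.\<close>
    have "(m + 1) * X + d * Y = (m + 1 - d) * (2 * (m + 1) - j) + 2 * m * ((m - d)\<^sup>2 - 1)"
      by (simp add: X_def Y_def power2_eq_square algebra_simps)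
    moreover have "(m + 1 - d) * (2 * (m + 1) - j) \<ge> 0"
      using assms by (intro mult_nonneg_nonneg) auto
    moreover have "2 * m * ((m - d)\<^sup>2 - 1) > 0"
      using e False assms by (intro mult_pos_pos) (auto simp: e_def)
    ultimately have "e * ((m + 1) * X + d * Y) > 0"
      using e False by simp
    moreover have "n * X \<ge> (m + 1) * e * X"
      using n X by (intro mult_right_mono) (auto simp: e_def)
    ultimately show ?thesis
      unfolding P by (simp add: algebra_simps)
  qed
qed

text \<open>\<open>X\<close> decreases in \<open>j\<close>; inserting the least \<open>j\<close>
  leaves a quadratic convex in \<open>d\<close>, so only the ends of the range of the gap have to be
  checked.\<close>

lemma defect_pos_upto_3:
  assumes "0 \<le> m" "m \<le> 3" "j \<ge> 2 * (1 + m)" "(m, j) \<notin> {(0, 2), (3, 8)}"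
    and d: "m - 1 \<le> d" "d \<le> 2 * m / 3" "d \<ge> 0" "m > 0 \<Longrightarrow> d > 0" and n: "n > 0"
  shows "defect m j d n > 0"
proof -
  define X where "X = 3 * d\<^sup>2 - 4 * m * d + 2 * m\<^sup>2 + 2 - j"
  consider "m = 0" | "m = 3" | "0 < m" "m < 3"
    using assms by linarith
  then have X: "X < 0"
  proof cases
    case 1
    then show ?thesis
      using assms by (auto simp: X_def)
  next
    case 2
    then have "d = 2" "j > 8"
      using assms by auto
    then show ?thesis
      using 2 by (simp add: X_def)
  next
    case 3
    have "d > 0"
      using 3 d by simp
    have u: "3 * (2 * m / 3)\<^sup>2 + - 4 * m * (2 * m / 3) + (2 * m\<^sup>2 - 2 * m) < 0"
    proof -
      have "3 * (2 * m / 3)\<^sup>2 + - 4 * m * (2 * m / 3) + (2 * m\<^sup>2 - 2 * m) = - (2 * m / 3 * (3 - m))"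
        by (simp add: power2_eq_square field_simps)
      then show ?thesis
        using 3 mult_pos_pos[of "2 * m / 3" "3 - m"] by linarith
    qed
    have "3 * d\<^sup>2 + - 4 * m * d + (2 * m\<^sup>2 - 2 * m) < 0"
    \<comment> \<open>The lower end of the range of \<open>d\<close> is the larger of 0 and
      \<open>m - 1\<close>. For \<open>m = 1\<close> the quadratic vanishes at that end, which
      \<open>d > 0\<close> excludes.\<close>
    proof (cases "m \<le> 1")
      case True
      have "m * m \<le> m * 1"
        using True 3 by (intro mult_left_mono) auto
      then show ?thesis
        using \<open>d > 0\<close> d u
        by (intro convex_quadratic_less_0[of 3 0 d "2 * m / 3" "- 4 * m"]) (auto simp: power2_eq_square)
    next
      case False
      have "3 * (m - 1)\<^sup>2 + - 4 * m * (m - 1) + (2 * m\<^sup>2 - 2 * m) = - ((m - 1) * (3 - m))"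
        by (simp add: power2_eq_square algebra_simps)
      moreover have "- ((m - 1) * (3 - m)) < 0"
        using False 3 by simp
      ultimately have "3 * (m - 1)\<^sup>2 + - 4 * m * (m - 1) + (2 * m\<^sup>2 - 2 * m) < 0"
        by linarith
      then show ?thesis
        using d u by (intro convex_quadratic_less_0[of 3 "m - 1" d "2 * m / 3" "- 4 * m"]) auto
    qed
    then show ?thesis
      unfolding X_def using assms(3) by auto
  qed
  have "(3 + m) * d \<le> (3 + m) * (2 * m / 3)"
    using assms by (intro mult_left_mono) auto
  moreover have "4 * m - (3 + m) * (2 * m / 3) = 2 * m / 3 * (3 - m)"
    by (simp add: field_simps)
  moreover have "2 * m / 3 * (3 - m) \<ge> 0"
    using assms by simp
  ultimately have "j - (3 + m) * d + 2 * (m - 1) \<ge> 0"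
    using assms(3) by argo
  then have "d * (d + 1 - m) * (j - (3 + m) * d + 2 * (m - 1)) \<ge> 0"
    using d by (intro mult_nonneg_nonneg) auto
  then show ?thesis
    using mult_pos_neg[OF n X] by (simp add: defect_def X_def)
qed

text \<open>Absorption into the first summand as in the negative case. Both \<open>X\<close> and
  \<open>(m + 1) * X + d * Y\<close> decrease in \<open>j\<close>, so \<open>j = m^2 - 1\<close> is
  the worst case, where convexity in \<open>d\<close> reduces them to the ends of the range.\<close>

lemma defect_pos_above_3:
  assumes "3 < m" "j \<ge> m\<^sup>2 - 1" "2 * m / 3 \<le> d" "d \<le> m - 1"
    and n: "n > 0" "n \<ge> (m + 1) * (m - 1 - d)"
  shows "defect m j d n > 0"
proof -
  define e where "e = m - 1 - d"
  define X where "X = 3 * d\<^sup>2 - 4 * m * d + 2 * m\<^sup>2 + 2 - j"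
  define Y where "Y = j - (3 + m) * d + 2 * (m - 1)"
  have e: "e \<ge> 0"
    using assms by (simp add: e_def)
  have X: "X < 0"
  proof -
    have "3 * (2 * m / 3)\<^sup>2 + - 4 * m * (2 * m / 3) + (m\<^sup>2 + 3) = - ((m - 3) * (m + 3) / 3)"
      by (simp add: power2_eq_square field_simps)
    moreover have "(m - 3) * (m + 3) / 3 > 0"
      using assms by simp
    ultimately have 1: "3 * (2 * m / 3)\<^sup>2 + - 4 * m * (2 * m / 3) + (m\<^sup>2 + 3) < 0"
      by linarith
    have "3 * (m - 1)\<^sup>2 + - 4 * m * (m - 1) + (m\<^sup>2 + 3) = 6 - 2 * m"
      by (simp add: power2_eq_square algebra_simps)
    then have 2: "3 * (m - 1)\<^sup>2 + - 4 * m * (m - 1) + (m\<^sup>2 + 3) < 0"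
      using assms by simp
    have "3 * d\<^sup>2 + - 4 * m * d + (m\<^sup>2 + 3) < 0"
      using assms 1 2
      by (intro convex_quadratic_less_0[of 3 "2 * m / 3" d "m - 1" "- 4 * m"]) auto
    then show ?thesis
      unfolding X_def using assms(2) by auto
  qed
  have P: "defect m j d n = - n * X - e * (d * Y)"
    by (simp add: defect_def X_def Y_def e_def algebra_simps)
  show ?thesis
  proof (cases "e = 0")
    case True
    then show ?thesis
      unfolding P using mult_pos_neg[OF n(1) X] by simp
  next
    case False
    have 1: "2 * m * (m - 1)\<^sup>2 + - (3 * m\<^sup>2 + 2 * m + 3) * (m - 1) + (m + 1) * (m\<^sup>2 + 3) < 0"
    proof -
      have "2 * m * (m - 1)\<^sup>2 + - (3 * m\<^sup>2 + 2 * m + 3) * (m - 1) + (m + 1) * (m\<^sup>2 + 3) =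
          - (2 * ((m - 3) * (m + 1)))"
        by (simp add: power2_eq_square algebra_simps)
      then show ?thesis
        using assms mult_pos_pos[of "m - 3" "m + 1"] by linarith
    qed
    have 2: "2 * m * (2 * m / 3)\<^sup>2 + - (3 * m\<^sup>2 + 2 * m + 3) * (2 * m / 3) + (m + 1) * (m\<^sup>2 + 3) < 0"
    proof -
      have "2 * m * (2 * m / 3)\<^sup>2 + - (3 * m\<^sup>2 + 2 * m + 3) * (2 * m / 3) + (m + 1) * (m\<^sup>2 + 3) =
          - ((m + 3) * ((m - 3) * (m + 3)) / 9)"
        by (simp add: power2_eq_square field_simps)
      moreover have "(m + 3) * ((m - 3) * (m + 3)) / 9 > 0"
        using assms by simp
      ultimately show ?thesis
        by linarith
    qed
    have Z: "2 * m * d\<^sup>2 + - (3 * m\<^sup>2 + 2 * m + 3) * d + (m + 1) * (m\<^sup>2 + 3) < 0"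
      using assms 1 2
      by (intro convex_quadratic_less_0[of "2 * m" "2 * m / 3" d "m - 1" "- (3 * m\<^sup>2 + 2 * m + 3)"]) auto
    have "(m + 1) * X + d * Y = - ((m + 1 - d) * (j - (m\<^sup>2 - 1)))
        + (2 * m * d\<^sup>2 + - (3 * m\<^sup>2 + 2 * m + 3) * d + (m + 1) * (m\<^sup>2 + 3))"
      by (simp add: X_def Y_def power2_eq_square algebra_simps)
    moreover have "(m + 1 - d) * (j - (m\<^sup>2 - 1)) \<ge> 0"
      using assms by (intro mult_nonneg_nonneg) auto
    ultimately have "(m + 1) * X + d * Y < 0"
      using Z by linarith
    then have *: "e * ((m + 1) * X + d * Y) < 0"
      using e False by (intro mult_pos_neg) auto
    have "n * X \<le> (m + 1) * e * X"
      using n X by (intro mult_right_mono_neg) (auto simp: e_def)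
    then show ?thesis
      unfolding P using * by (simp add: algebra_simps)
  qed
qed

subsection \<open>Comparison of the two Riccati solutions\<close>

text \<open>Minus the logarithmic derivative of \<open>A mu + A (- mu)\<close>, with the polynomial
  division carried out.\<close>

definition Q :: "real \<Rightarrow> real \<Rightarrow> real" where
  "Q mu s = (A mu s)\<^sup>2 - A mu s * A (- mu) s + (A (- mu) s)\<^sup>2 - 1 - mu * (A mu s - A (- mu) s)"

text \<open>The solution of \<open>G' = - 2 * G^2 - j * G\<close> with the singularity
  \<open>1 / (2 * s)\<close> at 0, which is also the leading singularity of
  \<open>Q\<close>.\<close>

definition G :: "real \<Rightarrow> real \<Rightarrow> real" where
  "G j s = (j / 2) / (exp (j * s) - 1)"

lemma Q_minus: "Q (- mu) s = Q mu s"
  by (simp add: Q_def algebra_simps)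

lemma Q_mult_sum:
  "Q mu s * (A mu s + A (- mu) s) =
     ((A mu s)\<^sup>2 - 1) * (A mu s - mu) + ((A (- mu) s)\<^sup>2 - 1) * (A (- mu) s + mu)"
  by (simp add: Q_def power2_eq_square algebra_simps)

lemma Q_pos:
  assumes "s > 0"
  shows "Q mu s > 0"
proof -
  note A = A_gt[OF assms, of mu] A_gt[OF assms, of "- mu"]
  then have "(A mu s)\<^sup>2 > 1" "(A (- mu) s)\<^sup>2 > 1"
    by auto
  then have "((A mu s)\<^sup>2 - 1) * (A mu s - mu) > 0" "((A (- mu) s)\<^sup>2 - 1) * (A (- mu) s + mu) > 0"
    using A by (auto intro!: mult_pos_pos)
  then have "Q mu s * (A mu s + A (- mu) s) > 0"
    unfolding Q_mult_sum by (rule add_pos_pos)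
  then show ?thesis
    using A by (simp add: zero_less_mult_iff)
qed

text \<open>A polynomial identity once the derivatives of both branches are replaced by their
  cubics.\<close>

lemma Q_deriv:
  fixes j mu s :: real
  assumes "s > 0"
  defines "d \<equiv> A mu s - A (- mu) s" and "n \<equiv> (A mu s + 1) * (A (- mu) s - 1)"
  shows "(Q mu has_real_derivative defect mu j d n - 2 * (Q mu s)\<^sup>2 - j * Q mu s) (at s)"
proof -
  define x where "x = A mu s"
  define y where "y = A (- mu) s"
  define x' where "x' = - (x\<^sup>2 - 1) * (x - mu)"
  define y' where "y' = - (y\<^sup>2 - 1) * (y - - mu)"
  have A': "(A mu has_real_derivative x') (at s)" "(A (- mu) has_real_derivative y') (at s)"
    using A_deriv[OF assms(1), of mu] A_deriv[OF assms(1), of "- mu"]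
    by (simp_all add: x'_def y'_def x_def y_def)
  have "(Q mu has_real_derivative
      (2 * x * x' - (x' * y + x * y') + 2 * y * y' - mu * (x' - y'))) (at s)"
    unfolding Q_def
    by (auto intro!: derivative_eq_intros A' simp: x_def y_def algebra_simps)
  moreover have "2 * x * x' - (x' * y + x * y') + 2 * y * y' - mu * (x' - y') =
      defect mu j d n - 2 * (Q mu s)\<^sup>2 - j * Q mu s"
    unfolding x'_def y'_def defect_def Q_def d_def n_def x_def[symmetric] y_def[symmetric]
    by algebra
  ultimately show ?thesis
    by simp
qed

lemma G_pos:
  assumes "j > 0" "s > 0"
  shows "G j s > 0"
  using assms by (simp add: G_def)

lemma sqrt_s_A_tendsto: "((\<lambda>s. sqrt s * A mu s) \<longlongrightarrow> sqrt (1 / 2)) (at_right 0)"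
proof -
  have "((\<lambda>s. sqrt (s * (A mu s)\<^sup>2)) \<longlongrightarrow> sqrt (1 / 2)) (at_right 0)"
    by (intro tendsto_intros s_A_sq_tendsto)
  moreover have "\<forall>\<^sub>F s in at_right 0. sqrt (s * (A mu s)\<^sup>2) = sqrt s * A mu s"
    using eventually_at_right_less[of 0]
  proof eventually_elim
    case (elim s)
    then show ?case
      using A_gt(1)[of s mu] by (simp add: real_sqrt_mult)
  qed
  ultimately show ?thesis
    by (rule Lim_transform_eventually)
qed

lemma sqrt_at_right_0: "(sqrt \<longlongrightarrow> 0) (at_right 0)"
  using tendsto_real_sqrt[OF tendsto_ident_at[of 0 "{0<..}"]] by simp

text \<open>Scaled by \<open>sqrt s\<close>, both branches tend to \<open>sqrt (1 / 2)\<close>: the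
  three quadratic terms give \<open>1 / 2 - 1 / 2 + 1 / 2\<close>, and the others vanish.\<close>

lemma s_Q_tendsto: "((\<lambda>s. s * Q mu s) \<longlongrightarrow> 1 / 2) (at_right 0)"
proof -
  define x where "x = (\<lambda>s. sqrt s * A mu s)"
  define y where "y = (\<lambda>s. sqrt s * A (- mu) s)"
  have "((\<lambda>s. (x s)\<^sup>2 - x s * y s + (y s)\<^sup>2 - (sqrt s)\<^sup>2 - mu * (sqrt s * (x s - y s))) \<longlongrightarrow>
      (sqrt (1 / 2))\<^sup>2 - sqrt (1 / 2) * sqrt (1 / 2) + (sqrt (1 / 2))\<^sup>2 - 0\<^sup>2 -
        mu * (0 * (sqrt (1 / 2) - sqrt (1 / 2)))) (at_right 0)"
    unfolding x_def y_def by (intro tendsto_intros sqrt_s_A_tendsto sqrt_at_right_0)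
  also have "(sqrt (1 / 2))\<^sup>2 - sqrt (1 / 2) * sqrt (1 / 2) + (sqrt (1 / 2))\<^sup>2 - 0\<^sup>2 -
        mu * (0 * (sqrt (1 / 2) - sqrt (1 / 2))) = (1 / 2 :: real)"
    by (simp add: power2_eq_square)
  finally have *: "((\<lambda>s. (x s)\<^sup>2 - x s * y s + (y s)\<^sup>2 - (sqrt s)\<^sup>2 - mu * (sqrt s * (x s - y s))) \<longlongrightarrow> 1 / 2)
      (at_right 0)" .
  show ?thesis
  proof (rule Lim_transform_eventually[OF *])
    show "\<forall>\<^sub>F s in at_right 0. (x s)\<^sup>2 - x s * y s + (y s)\<^sup>2 - (sqrt s)\<^sup>2 - mu * (sqrt s * (x s - y s)) = s * Q mu s"
      using eventually_at_right_less[of 0]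
    proof eventually_elim
      case (elim s)
      define t where "t = sqrt s"
      have "s = t\<^sup>2"
        using elim by (simp add: t_def)
      then show ?case
        unfolding x_def y_def Q_def t_def[symmetric] by (simp add: power2_eq_square algebra_simps)
    qed
  qed
qed

lemma inverse_Q_tendsto: "((\<lambda>s. 1 / Q mu s) \<longlongrightarrow> 0) (at_right 0)"
proof -
  have "((\<lambda>s. s / (s * Q mu s)) \<longlongrightarrow> 0 / (1 / 2)) (at_right 0)"
    by (intro tendsto_divide s_Q_tendsto tendsto_ident_at) auto
  then have *: "((\<lambda>s. s / (s * Q mu s)) \<longlongrightarrow> 0) (at_right 0)"
    by simp
  show ?thesis
    by (rule Lim_transform_eventually[OF *])
      (use eventually_at_right_less[of "0::real"] in eventually_elim, simp)
qed

text \<open>\<open>u = 1 / Q - 1 / G\<close> solves the linear equation \<open>u' = j u - P / Q\<^sup>2\<close>, where \<open>P\<close> is the defect.\<close>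

lemma Riccati_difference_deriv:
  fixes j mu s :: real
  assumes j: "j > 0" and s: "s > 0"
  defines "d \<equiv> A mu s - A (- mu) s" and "n \<equiv> (A mu s + 1) * (A (- mu) s - 1)"
  shows "((\<lambda>s. (1 / Q mu s - 1 / G j s) * exp (- j * s)) has_real_derivative
           - defect mu j d n / (Q mu s)\<^sup>2 * exp (- j * s)) (at s)"
proof -
  define z where "z = exp (j * s)"
  have nz: "Q mu s \<noteq> 0"
    using Q_pos[OF s, of mu] by simp
  have G: "1 / G j s = 2 / j * (exp (j * s) - 1)" for s
    by (simp add: G_def)
  have "((\<lambda>s. (1 / Q mu s - 2 / j * (exp (j * s) - 1)) * exp (- j * s)) has_real_derivative
      (- (defect mu j d n - 2 * (Q mu s)\<^sup>2 - j * Q mu s) / (Q mu s)\<^sup>2 - 2 / j * (j * exp (j * s))) * exp (- j * s)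
      + (1 / Q mu s - 2 / j * (exp (j * s) - 1)) * (- j * exp (- j * s))) (at s)"
    using nz j unfolding d_def n_def
    by (auto intro!: derivative_eq_intros Q_deriv[OF s, where j = j]
        simp: power2_eq_square simp del: mult_minus_left)
  moreover have "(- (defect mu j d n - 2 * (Q mu s)\<^sup>2 - j * Q mu s) / (Q mu s)\<^sup>2 - 2 / j * (j * exp (j * s))) * exp (- j * s)
      + (1 / Q mu s - 2 / j * (exp (j * s) - 1)) * (- j * exp (- j * s)) =
      - defect mu j d n / (Q mu s)\<^sup>2 * exp (- j * s)"
    using nz j by (simp add: field_simps power2_eq_square)
  ultimately show ?thesis
    unfolding G by simp
qed

lemma Riccati_difference_tendsto:
  assumes j: "j > 0"
  shows "((\<lambda>s. (1 / Q mu s - 1 / G j s) * exp (- j * s)) \<longlongrightarrow> 0) (at_right 0)"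
proof -
  have "((\<lambda>s. (1 / Q mu s - 2 / j * (exp (j * s) - 1)) * exp (- j * s)) \<longlongrightarrow>
      (0 - 2 / j * (exp (j * 0) - 1)) * exp (- j * 0)) (at_right 0)"
    by (intro tendsto_intros inverse_Q_tendsto)
  then show ?thesis
    by (simp add: G_def)
qed

text \<open>A negative defect makes the weighted difference of \<open>1 / Q\<close> and
  \<open>1 / G\<close> increase from its limit 0.\<close>

lemma Q_less_G:
  assumes j: "j > 0" and s: "s > 0"
    and neg: "\<And>s. s > 0 \<Longrightarrow> defect mu j (A mu s - A (- mu) s) ((A mu s + 1) * (A (- mu) s - 1)) < 0"
  shows "Q mu s < G j s"
proof -
  have "(1 / Q mu s - 1 / G j s) * exp (- j * s) > 0"
  proof (rule pos_if_increasing_from_0[OF Riccati_difference_deriv[OF j] _ Riccati_difference_tendsto[OF j] s])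
    fix y :: real
    assume "y > 0"
    then show "- defect mu j (A mu y - A (- mu) y) ((A mu y + 1) * (A (- mu) y - 1)) / (Q mu y)\<^sup>2 * exp (- j * y) > 0"
      using neg[of y] Q_pos[of y mu] by (intro mult_pos_pos divide_pos_pos) auto
  qed
  then have "1 / Q mu s > 1 / G j s"
    by (simp add: zero_less_mult_iff)
  then show ?thesis
    using Q_pos[OF s, of mu] G_pos[OF j s] by (simp add: field_simps)
qed

lemma Q_greater_G:
  assumes j: "j > 0" and s: "s > 0"
    and pos: "\<And>s. s > 0 \<Longrightarrow> defect mu j (A mu s - A (- mu) s) ((A mu s + 1) * (A (- mu) s - 1)) > 0"
  shows "Q mu s > G j s"
proof -
  have "- ((1 / Q mu s - 1 / G j s) * exp (- j * s)) > 0"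
  proof (rule pos_if_increasing_from_0[OF DERIV_minus[OF Riccati_difference_deriv[OF j]] _ _ s])
    fix y :: real
    assume "y > 0"
    then show "- (- defect mu j (A mu y - A (- mu) y) ((A mu y + 1) * (A (- mu) y - 1)) / (Q mu y)\<^sup>2 * exp (- j * y)) > 0"
      using pos[of y] Q_pos[of y mu] by simp
  next
    show "((\<lambda>s. - ((1 / Q mu s - 1 / G j s) * exp (- j * s))) \<longlongrightarrow> 0) (at_right 0)"
      using tendsto_minus[OF Riccati_difference_tendsto[OF j, of mu]] by simp
  qed
  then have "1 / Q mu s < 1 / G j s"
    by (simp add: mult_less_0_iff)
  then show ?thesis
    using Q_pos[OF s, of mu] G_pos[OF j s] by (simp add: field_simps)
qed

text \<open>The inequality \<open>A mu s > mu\<close> bounds the first factor of \<open>n\<close>;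
  shifted by \<open>d\<close>, it bounds the second one.\<close>

lemma defect_arguments:
  fixes mu s :: real
  assumes s: "s > 0"
  defines "d \<equiv> A mu s - A (- mu) s" and "n \<equiv> (A mu s + 1) * (A (- mu) s - 1)"
  shows "n > 0" "0 \<le> mu \<Longrightarrow> d \<le> mu - 1 \<Longrightarrow> n \<ge> (mu + 1) * (mu - 1 - d)"
proof -
  note A = A_gt[OF s, of mu] A_gt[OF s, of "- mu"]
  show "n > 0"
    using A by (auto simp: n_def)
  show "n \<ge> (mu + 1) * (mu - 1 - d)" if "0 \<le> mu" "d \<le> mu - 1"
    unfolding n_def using A that by (intro mult_mono) (auto simp: d_def)
qed

text \<open>\<open>Q\<close> is even in \<open>mu\<close>, which reduces to
  \<open>m = \<bar>mu\<bar>\<close>. In the first alternative \<open>j > 0\<close> forces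
  \<open>m < 1\<close>. In the second one the bounds \<open>m^2 - 1\<close> and
  \<open>2 * (m + 1)\<close> cross at \<open>m = 3\<close>, and on each side the smaller one is
  used.\<close>

lemma Q_less_G_cases:
  assumes j: "j > 0" and s: "s > 0"
    and cases: "(j \<le> 2 * (1 - \<bar>mu\<bar>) \<and> (mu, j) \<noteq> (0, 2)) \<or>
      (\<bar>mu\<bar> > 1 \<and> j \<le> mu\<^sup>2 - 1 \<and> j \<le> 2 * (\<bar>mu\<bar> + 1) \<and> (\<bar>mu\<bar>, j) \<noteq> (3, 8))"
  shows "Q mu s < G j s"
proof -
  define m where "m = \<bar>mu\<bar>"
  have m: "m \<ge> 0" "m\<^sup>2 = mu\<^sup>2"
    by (auto simp: m_def)
  have "Q m s < G j s"
  proof (rule Q_less_G[OF j s])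
    fix s :: real
    assume s: "s > 0"
    define d where "d = A m s - A (- m) s"
    define n where "n = (A m s + 1) * (A (- m) s - 1)"
    note n = defect_arguments[OF s, of m, folded d_def n_def]
    have d: "d \<ge> 0" "m = 0 \<Longrightarrow> d = 0"
      using gap_pos[OF s, of m] m by (cases "m = 0"; simp add: d_def)+
    consider "m < 1" "j \<le> 2 * (1 - m)" "(m, j) \<noteq> (0, 2)"
      | "1 < m" "m \<le> 3" "j \<le> m\<^sup>2 - 1" "(m, j) \<noteq> (3, 8)"
      | "3 < m" "j \<le> 2 * (m + 1)"
      using cases j unfolding m(2) m_def[symmetric] by (force simp: m_def)
    then have "defect m j d n < 0"
    proof cases
      case 1
      then show ?thesis
        using d m n by (intro defect_neg_below_1) auto
    next
      case 2
      then show ?thesis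
        using gap_bounds_small[OF s, of m, folded d_def] n by (intro defect_neg_1_to_3) auto
    next
      case 3
      then show ?thesis
        using gap_bounds_large[OF s, of m, folded d_def] n by (intro defect_neg_above_3) auto
    qed
    then show "defect m j (A m s - A (- m) s) ((A m s + 1) * (A (- m) s - 1)) < 0"
      by (simp add: d_def n_def)
  qed
  then show ?thesis
    by (cases "mu \<ge> 0") (auto simp: m_def Q_minus)
qed

text \<open>The lower bounds cross at \<open>m = 3\<close> as well; now the larger one is used on
  each side.\<close>

lemma Q_greater_G_cases:
  assumes j: "j > 0" and s: "s > 0"
    and cases: "j \<ge> 2 * (1 + \<bar>mu\<bar>)" "j \<ge> mu\<^sup>2 - 1" "(\<bar>mu\<bar>, j) \<notin> {(0, 2), (3, 8)}"
  shows "Q mu s > G j s"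
proof -
  define m where "m = \<bar>mu\<bar>"
  have m: "m \<ge> 0" "m\<^sup>2 = mu\<^sup>2"
    by (auto simp: m_def)
  have "Q m s > G j s"
  proof (rule Q_greater_G[OF j s])
    fix s :: real
    assume s: "s > 0"
    define d where "d = A m s - A (- m) s"
    define n where "n = (A m s + 1) * (A (- m) s - 1)"
    note n = defect_arguments[OF s, of m, folded d_def n_def]
    have d: "d \<ge> 0" "m > 0 \<Longrightarrow> d > 0"
      using gap_pos[OF s, of m] m by (cases "m = 0"; simp add: d_def)+
    have "defect m j d n > 0"
    proof (cases "m \<le> 3")
      case True
      then show ?thesis
        using gap_bounds_small[OF s, of m, folded d_def] n d m cases
        by (intro defect_pos_upto_3) (auto simp: m_def)
    next
      case False
      then show ?thesis
        using gap_bounds_large[OF s, of m, folded d_def] n m cases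
        by (intro defect_pos_above_3) auto
    qed
    then show "defect m j (A m s - A (- m) s) ((A m s + 1) * (A (- m) s - 1)) > 0"
      by (simp add: d_def n_def)
  qed
  then show ?thesis
    by (cases "mu \<ge> 0") (auto simp: m_def Q_minus)
qed

subsection \<open>Parametrised integrals\<close>

text \<open>Substitution for an \<open>f\<close> that may be singular at the ends, where only the
  product \<open>m\<close> is continuous. A primitive of \<open>m\<close> composed with the inverse
  of \<open>X\<close> is continuous up to the ends and a primitive of \<open>f\<close> inside, which
  suffices for the Henstock-Kurzweil integral.\<close>

lemma has_integral_parametrised_increasing:
  fixes X X' f m :: "real \<Rightarrow> real"
  assumes ab: "\<alpha> < \<beta>" and contX: "continuous_on {\<alpha>..\<beta>} X" and contm: "continuous_on {\<alpha>..\<beta>} m"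
    and X: "\<And>t. \<alpha> < t \<Longrightarrow> t < \<beta> \<Longrightarrow> (X has_real_derivative X' t) (at t)"
    and X': "\<And>t. \<alpha> < t \<Longrightarrow> t < \<beta> \<Longrightarrow> X' t > 0"
    and f: "\<And>t. \<alpha> < t \<Longrightarrow> t < \<beta> \<Longrightarrow> f (X t) * X' t = m t"
  shows "(f has_integral integral {\<alpha>..\<beta>} m) {X \<alpha>..X \<beta>}"
proof -
  have mono: "X s < X t" if "\<alpha> \<le> s" "s < t" "t \<le> \<beta>" for s t
  proof (rule DERIV_pos_imp_increasing_open[OF that(2)])
    show "\<exists>y. (X has_real_derivative y) (at x) \<and> 0 < y" if "s < x" "x < t" for x
      using X[of x] X'[of x] that \<open>\<alpha> \<le> s\<close> \<open>t \<le> \<beta>\<close> by auto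
    show "continuous_on {s..t} X"
      using that by (intro continuous_on_subset[OF contX]) auto
  qed
  then have inj: "inj_on X {\<alpha>..\<beta>}"
    by (intro linorder_inj_onI') fastforce
  define g where "g = the_inv_into {\<alpha>..\<beta>} X"
  have g: "g (X t) = t" if "t \<in> {\<alpha>..\<beta>}" for t
    unfolding g_def using that inj by (rule the_inv_into_f_f[rotated])
  have ex: "\<exists>t. \<alpha> \<le> t \<and> t \<le> \<beta> \<and> X t = x" if "X \<alpha> \<le> x" "x \<le> X \<beta>" for x
    using IVT'[of X \<alpha> x \<beta>] that ab contX by auto
  have image: "X ` {\<alpha>..\<beta>} = {X \<alpha>..X \<beta>}"
  proof
    show "X ` {\<alpha>..\<beta>} \<subseteq> {X \<alpha>..X \<beta>}"
      using mono[of \<alpha>] mono[of _ \<beta>] by (force simp: le_less)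
    show "{X \<alpha>..X \<beta>} \<subseteq> X ` {\<alpha>..\<beta>}"
      using ex by force
  qed
  have contg: "continuous_on {X \<alpha>..X \<beta>} g"
    unfolding image[symmetric] using g by (intro continuous_on_inv contX) auto
  define M where "M = (\<lambda>t. integral {\<alpha>..t} m)"
  have M: "(M has_real_derivative m t) (at t within {\<alpha>..\<beta>})" if "t \<in> {\<alpha>..\<beta>}" for t
    unfolding M_def has_real_derivative_iff_has_vector_derivative
    by (rule integral_has_vector_derivative[OF contm that])
  have contM: "continuous_on {\<alpha>..\<beta>} M"
    unfolding continuous_on_eq_continuous_within using M DERIV_continuous by blast
  have "(f has_integral M (g (X \<beta>)) - M (g (X \<alpha>))) {X \<alpha>..X \<beta>}"
  proof (rule fundamental_theorem_of_calculus_interior)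
    show "X \<alpha> \<le> X \<beta>"
      using mono[of \<alpha> \<beta>] ab by simp
    show "continuous_on {X \<alpha>..X \<beta>} (\<lambda>x. M (g x))"
      using g by (intro continuous_on_compose2[OF contM contg]) (auto simp: image[symmetric])
  next
    fix x
    assume x: "x \<in> {X \<alpha><..<X \<beta>}"
    then obtain t where t: "\<alpha> \<le> t" "t \<le> \<beta>" "X t = x"
      using ex[of x] by auto
    then have t': "\<alpha> < t" "t < \<beta>"
      using x by (auto simp: le_less)
    have "(g has_real_derivative inverse (X' t)) (at (X t))"
    proof (rule has_field_derivative_inverse_strong[where f = X and S = "{\<alpha><..<\<beta>}"])
      show "continuous_on {\<alpha><..<\<beta>} X"
        by (intro continuous_on_subset[OF contX]) auto
      show "(X has_real_derivative X' t) (at t)"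
        using t' by (rule X)
    qed (use t' X'[of t] g in auto)
    moreover have "(M has_real_derivative m t) (at (g (X t)))"
      using M[of t] t' g[of t] at_within_Icc_at[of \<alpha> t \<beta>] by simp
    ultimately have "((\<lambda>x. M (g x)) has_real_derivative m t * inverse (X' t)) (at (X t))"
      by (intro DERIV_chain2[of M])
    moreover have "m t * inverse (X' t) = f x"
      using f[of t] X'[of t] t' t by (simp add: field_simps)
    ultimately show "((\<lambda>x. M (g x)) has_vector_derivative f x) (at x)"
      using t by (simp add: has_real_derivative_iff_has_vector_derivative)
  qed
  then show ?thesis
    using g[of \<alpha>] g[of \<beta>] ab by (simp add: M_def)
qed

text \<open>Reflecting the parameter reduces this to the increasing case.\<close>

lemma has_integral_parametrised_decreasing:
  fixes X X' f m :: "real \<Rightarrow> real"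
  assumes ab: "\<alpha> < \<beta>" and contX: "continuous_on {\<alpha>..\<beta>} X" and contm: "continuous_on {\<alpha>..\<beta>} m"
    and X: "\<And>t. \<alpha> < t \<Longrightarrow> t < \<beta> \<Longrightarrow> (X has_real_derivative - X' t) (at t)"
    and X': "\<And>t. \<alpha> < t \<Longrightarrow> t < \<beta> \<Longrightarrow> X' t > 0"
    and f: "\<And>t. \<alpha> < t \<Longrightarrow> t < \<beta> \<Longrightarrow> f (X t) * X' t = m t"
  shows "(f has_integral integral {\<alpha>..\<beta>} m) {X \<beta>..X \<alpha>}"
proof -
  have "(f has_integral integral {- \<beta>..- \<alpha>} (\<lambda>t. m (- t))) {X (- (- \<beta>))..X (- (- \<alpha>))}"
  proof (rule has_integral_parametrised_increasing[where X = "\<lambda>t. X (- t)" and X' = "\<lambda>t. X' (- t)"])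
    show "continuous_on {- \<beta>..- \<alpha>} (\<lambda>t. X (- t))" "continuous_on {- \<beta>..- \<alpha>} (\<lambda>t. m (- t))"
      by (auto intro!: continuous_intros continuous_on_compose2[OF contX] continuous_on_compose2[OF contm])
  next
    fix t
    assume t: "- \<beta> < t" "t < - \<alpha>"
    have "((\<lambda>t. X (- t)) has_real_derivative - X' (- t) * - 1) (at t)"
      using t by (intro DERIV_chain2[where f = X] X) (auto intro!: derivative_eq_intros)
    then show "((\<lambda>t. X (- t)) has_real_derivative X' (- t)) (at t)"
      by simp
  qed (use ab X' f in auto)
  then show ?thesis
    by (simp add: Henstock_Kurzweil_Integration.integral_reflect_real)
qed

subsection \<open>The two branches of the level sets\<close>

text \<open>The continuous extension to \<open>p = 0\<close> of \<open>(x\<^sup>p - 1) / p\<close>, with \<open>x = e\<^sup>t\<close>.\<close>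

definition E :: "real \<Rightarrow> real \<Rightarrow> real" where
  "E p t = (if p = 0 then t else (exp (p * t) - 1) / p)"

lemma E_deriv: "(E p has_real_derivative exp (p * t)) (at t)"
proof (cases "p = 0")
  case True
  then have "E p = (\<lambda>t. t)"
    by (auto simp: E_def)
  then show ?thesis
    using True by simp
next
  case False
  then have "E p = (\<lambda>t. (exp (p * t) - 1) / p)"
    by (auto simp: E_def)
  then show ?thesis
    using False by (auto intro!: derivative_eq_intros)
qed

lemma E_0 [simp]: "E p 0 = 0"
  by (simp add: E_def)

lemma E_nonzero:
  assumes "t \<noteq> 0"
  shows "E p t \<noteq> 0"
  using assms by (auto simp: E_def)

text \<open>In logarithmic coordinates all three formulas for \<open>F\<close> say that
  \<open>E q y\<close> is proportional to \<open>E p t\<close>, with the factor fixed by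
  \<open>y = L\<close> at \<open>t = L\<close>.\<close>

lemma Theta_F_exp:
  assumes "p < q" "L > 0"
    and t: "E q y = K * E p t" and L: "E q L = K * E p L"
  shows "Theta_F p q (exp L) (exp t) = exp (2 * y)"
proof -
  have eq: "E q y * E p L = E q L * E p t"
    using t L by (simp add: algebra_simps)
  have nz: "E p L \<noteq> 0"
    using assms E_nonzero[of L p] by simp
  have pow: "exp (q * y) powr (2 / q) = exp (2 * y)" if "q \<noteq> 0"
    using that by (simp add: powr_def)
  consider "p = 0" "q \<noteq> 0" | "q = 0" "p \<noteq> 0" | "p \<noteq> 0" "q \<noteq> 0"
    using assms by force
  then show ?thesis
  proof cases
    case 1
    then have "exp (q * y) = 1 + (exp (q * L) - 1) / L * t"
      using eq assms by (simp add: E_def field_simps)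
    then show ?thesis
      using pow[OF 1(2)] 1 by (simp add: Theta_F_def powr_def)
  next
    case 2
    then have "L * (2 * (exp (p * t) - 1)) / (exp (p * L) - 1) = 2 * y"
      using eq nz by (simp add: E_def field_simps)
    then show ?thesis
      using 2 by (simp add: Theta_F_def powr_def mult.commute[of L])
  next
    case 3
    then have nz': "exp (p * L) - 1 \<noteq> 0"
      using nz by (auto simp: E_def)
    have "(exp (q * y) - 1) * (exp (p * L) - 1) = (exp (q * L) - 1) * (exp (p * t) - 1)"
      using eq 3 by (simp add: E_def field_simps)
    then have "exp (q * y) = (exp (p * L) - exp (q * L)) / (exp (p * L) - 1)
        + (exp (q * L) - 1) / (exp (p * L) - 1) * exp (p * t)"
      using nz' by (simp add: divide_simps) (simp add: algebra_simps)
    then show ?thesis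
      using pow[OF 3(2)] 3 by (simp add: Theta_F_def powr_def)
  qed
qed

section \<open>The substitution of an angle for the depth below the maximal gap\<close>

definition level :: "real \<Rightarrow> real \<Rightarrow> real" where
  "level h \<theta> = ln (1 + (exp (2 * h) - 1) * (sin \<theta>)\<^sup>2) / 2"

lemma level_arg_pos:
  fixes h \<theta> :: real
  assumes "h \<ge> 0"
  shows "1 + (exp (2 * h) - 1) * (sin \<theta>)\<^sup>2 > 0" "1 + (exp (2 * h) - 1) * (sin \<theta>)\<^sup>2 \<ge> 1"
  using assms by (auto intro!: add_pos_nonneg)

lemma exp_level:
  assumes "h \<ge> 0"
  shows "exp (2 * level h \<theta>) = 1 + (exp (2 * h) - 1) * (sin \<theta>)\<^sup>2"
  using level_arg_pos[OF assms, of \<theta>] by (simp add: level_def)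

lemma level_nonneg: "h \<ge> 0 \<Longrightarrow> level h \<theta> \<ge> 0"
  using level_arg_pos[of h \<theta>] by (simp add: level_def)

lemma level_0 [simp]: "level h 0 = 0"
  by (simp add: level_def)

lemma level_pi_half [simp]: "level h (pi / 2) = h"
  by (simp add: level_def)

lemma level_strict_bounds:
  assumes "h > 0" "0 < \<theta>" "\<theta> < pi / 2"
  shows "0 < level h \<theta>" "level h \<theta> < h"
proof -
  have sc: "sin \<theta> > 0" "cos \<theta> > 0"
    using assms by (auto intro!: sin_gt_zero cos_gt_zero)
  have "exp (2 * level h \<theta>) > 1"
    unfolding exp_level[OF less_imp_le[OF assms(1)]] using assms sc by simp
  then show "0 < level h \<theta>"
    by simp
  have "(exp (2 * h) - 1) * (sin \<theta>)\<^sup>2 = (exp (2 * h) - 1) - (exp (2 * h) - 1) * (cos \<theta>)\<^sup>2"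
    by (simp add: sin_squared_eq algebra_simps)
  moreover have "(exp (2 * h) - 1) * (cos \<theta>)\<^sup>2 > 0"
    using assms sc by simp
  ultimately have "exp (2 * level h \<theta>) < exp (2 * h)"
    unfolding exp_level[OF less_imp_le[OF assms(1)]] by simp
  then show "level h \<theta> < h"
    by simp
qed

lemma continuous_on_level [continuous_intros]:
  fixes f g :: "'a::t2_space \<Rightarrow> real"
  assumes "continuous_on S f" "continuous_on S g" "\<And>x. x \<in> S \<Longrightarrow> f x \<ge> 0"
  shows "continuous_on S (\<lambda>x. level (f x) (g x))"
  unfolding level_def using assms level_arg_pos(1)
  by (intro continuous_intros) (auto simp: less_imp_neq[symmetric])

lemma level_deriv_theta:
  assumes "h \<ge> 0"
  shows "(level h has_real_derivative
    (exp (2 * h) - 1) * (sin \<theta> * cos \<theta>) / exp (2 * level h \<theta>)) (at \<theta>)"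
proof -
  define H where "H = exp (2 * h) - 1"
  have D: "1 + H * (sin \<theta>)\<^sup>2 > 0"
    unfolding H_def by (rule level_arg_pos(1)[OF assms])
  have "((\<lambda>\<theta>. ln (1 + H * (sin \<theta>)\<^sup>2)) has_real_derivative
      H * (2 * (sin \<theta> * cos \<theta>)) / (1 + H * (sin \<theta>)\<^sup>2)) (at \<theta>)"
    using D by (auto intro!: derivative_eq_intros)
  from DERIV_cdivide[OF this, of 2] have "((\<lambda>\<theta>. ln (1 + H * (sin \<theta>)\<^sup>2) / 2) has_real_derivative
      H * (sin \<theta> * cos \<theta>) / (1 + H * (sin \<theta>)\<^sup>2)) (at \<theta>)"
    by (rule DERIV_cong) (use D in \<open>simp add: field_simps\<close>)
  then show ?thesis
    unfolding exp_level[OF assms] unfolding level_def[abs_def] H_def .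
qed

lemma level_deriv_h:
  assumes "h \<ge> 0"
  shows "((\<lambda>h. level h \<theta>) has_real_derivative exp (2 * h) * (sin \<theta>)\<^sup>2 / exp (2 * level h \<theta>)) (at h)"
proof -
  have half: "2 * x * y / D / 2 = x * y / D" for x y D :: real
    by simp
  have "((\<lambda>h. ln (1 + (exp (2 * h) - 1) * (sin \<theta>)\<^sup>2)) has_real_derivative
      2 * exp (2 * h) * (sin \<theta>)\<^sup>2 / (1 + (exp (2 * h) - 1) * (sin \<theta>)\<^sup>2)) (at h)"
    using level_arg_pos[OF assms, of \<theta>] by (auto intro!: derivative_eq_intros)
  from DERIV_cdivide[OF this, of 2] have "((\<lambda>h. ln (1 + (exp (2 * h) - 1) * (sin \<theta>)\<^sup>2) / 2) has_real_derivative
      exp (2 * h) * (sin \<theta>)\<^sup>2 / (1 + (exp (2 * h) - 1) * (sin \<theta>)\<^sup>2)) (at h)"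
    by (rule DERIV_cong) (rule half)
  then show ?thesis
    unfolding exp_level[OF assms] unfolding level_def[abs_def] .
qed

lemma one_minus_exp_level:
  assumes "h \<ge> 0"
  shows "1 - exp (- 2 * level h \<theta>) = (exp (2 * h) - 1) * (sin \<theta>)\<^sup>2 / exp (2 * level h \<theta>)"
  using exp_level[OF assms, of \<theta>] by (simp add: exp_minus field_simps)

text \<open>The weight of the singular integrand becomes bounded in the variable \<open>\<theta>\<close>.\<close>

lemma level_weight:
  assumes "h > 0" "0 < \<theta>" "\<theta> < pi / 2"
  shows "(exp (2 * h) - 1) * (sin \<theta> * cos \<theta>) / exp (2 * level h \<theta>) / sqrt (exp (2 * (h - level h \<theta>)) - 1)
    = sqrt (1 - exp (- 2 * level h \<theta>))"
proof -
  define H where "H = exp (2 * h) - 1"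
  define D where "D = exp (2 * level h \<theta>)"
  have sc: "sin \<theta> > 0" "cos \<theta> > 0"
    using assms by (auto intro!: sin_gt_zero cos_gt_zero)
  have D: "D = 1 + H * (sin \<theta>)\<^sup>2"
    using exp_level[of h \<theta>] assms by (simp add: D_def H_def)
  have "D > 0"
    by (simp add: D_def)
  have H: "H > 0"
    using assms by (simp add: H_def)
  have "exp (2 * (h - level h \<theta>)) - 1 = (H + 1) / D - 1"
    by (simp add: H_def D_def exp_diff right_diff_distrib)
  also have "\<dots> = H * (cos \<theta>)\<^sup>2 / D"
    using \<open>D > 0\<close> unfolding D by (simp add: cos_squared_eq field_simps)
  finally have 1: "sqrt (exp (2 * (h - level h \<theta>)) - 1) = sqrt H * cos \<theta> / sqrt D"
    using sc by (simp add: real_sqrt_divide real_sqrt_mult)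
  have 2: "sqrt (1 - exp (- 2 * level h \<theta>)) = sqrt H * sin \<theta> / sqrt D"
    unfolding one_minus_exp_level[OF less_imp_le[OF assms(1)]] using sc
    by (simp add: real_sqrt_divide real_sqrt_mult H_def D_def)
  have "H = sqrt H * sqrt H" "D = sqrt D * sqrt D"
    using H \<open>D > 0\<close> by auto
  then have "H * (sin \<theta> * cos \<theta>) / D / (sqrt H * cos \<theta> / sqrt D) = sqrt H * sin \<theta> / sqrt D"
    using H \<open>D > 0\<close> sc by (simp add: field_simps)
  then show ?thesis
    unfolding 1 2 by (simp add: H_def D_def)
qed

section \<open>Explicit branches on both sides of the maximal gap\<close>

locale exponents =
  fixes p q :: real
  assumes less: "p < q"
begin

definition k :: real where "k = q - p"
definition mu :: real where "mu = (p + q) / k"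

lemma k_pos: "k > 0"
  using less by (simp add: k_def)

lemma q_over_k: "q / k = (1 + mu) / 2"
  using k_pos by (simp add: mu_def k_def field_simps)

text \<open>Where the gap \<open>y - t\<close> has the value \<open>h - c\<close>, to the right and to the left of its maximum \<open>h\<close>.\<close>

definition tR :: "real \<Rightarrow> real \<Rightarrow> real" where
  "tR h c = 2 / k * (a mu (k / 4 * c) + a (- mu) (k / 4 * h)) - q / k * (h - c)"

definition tL :: "real \<Rightarrow> real \<Rightarrow> real" where
  "tL h c = 2 / k * (a (- mu) (k / 4 * h) - a (- mu) (k / 4 * c)) - q / k * (h - c)"

text \<open>At \<open>c = h\<close> the gap has returned to 0, so this is the logarithm of the
  endpoint \<open>r\<close>.\<close>

definition L :: "real \<Rightarrow> real" where
  "L h = tR h h"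

lemma tR_0: "tR h 0 = tL h 0"
  by (simp add: tR_def tL_def)

lemma tL_h: "tL h h = 0"
  by (simp add: tL_def)

lemma a_scaled_deriv:
  assumes "c > 0"
  shows "((\<lambda>c. a nu (k / 4 * c)) has_real_derivative k / 4 * (A nu (k / 4 * c) - nu)) (at c)"
proof -
  have "((\<lambda>c. a nu (k / 4 * c)) has_real_derivative (A nu (k / 4 * c) - nu) * (k / 4)) (at c)"
    using assms k_pos by (intro DERIV_chain2[where f = "a nu"] a_deriv) (auto intro!: derivative_eq_intros)
  then show ?thesis
    by (simp add: mult.commute)
qed

lemma tR_deriv:
  assumes "c > 0"
  shows "(tR h has_real_derivative (A mu (k / 4 * c) + 1) / 2) (at c)"
proof -
  have "(tR h has_real_derivative 2 / k * (k / 4 * (A mu (k / 4 * c) - mu)) + q / k) (at c)"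
    unfolding tR_def[abs_def] by (rule a_scaled_deriv[OF assms] derivative_eq_intros refl)+ simp
  moreover have "2 / k * (k / 4 * (A mu (k / 4 * c) - mu)) + q / k = (A mu (k / 4 * c) + 1) / 2"
    unfolding q_over_k using k_pos by (simp add: field_simps)
  ultimately show ?thesis
    by (simp only:)
qed

lemma tL_deriv:
  assumes "c > 0"
  shows "(tL h has_real_derivative - ((A (- mu) (k / 4 * c) - 1) / 2)) (at c)"
proof -
  have "(tL h has_real_derivative - 2 / k * (k / 4 * (A (- mu) (k / 4 * c) - - mu)) + q / k) (at c)"
    unfolding tL_def[abs_def] by (rule a_scaled_deriv[OF assms] derivative_eq_intros refl)+ simp
  moreover have "- 2 / k * (k / 4 * (A (- mu) (k / 4 * c) - - mu)) + q / k = - ((A (- mu) (k / 4 * c) - 1) / 2)"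
    unfolding q_over_k using k_pos by (simp add: field_simps)
  ultimately show ?thesis
    by (simp only:)
qed

lemma continuous_on_a_scaled: "continuous_on {0..} (\<lambda>c. a nu (k / 4 * c))"
  using k_pos by (intro continuous_on_compose2[OF continuous_on_a] continuous_intros) auto

lemma continuous_on_tR: "continuous_on {0..} (tR h)"
  unfolding tR_def[abs_def] by (intro continuous_intros continuous_on_a_scaled)

lemma continuous_on_tL: "continuous_on {0..} (tL h)"
  unfolding tL_def[abs_def] by (intro continuous_intros continuous_on_a_scaled)

text \<open>With \<open>y = t + (h - c)\<close>, the relation \<open>rel\<close> says that
  \<open>E q y - K * E p t\<close> has derivative 0. Continuity of \<open>t\<close> extends this to
  \<open>c = 0\<close>, the point of maximal gap.\<close>

lemma conserved_constant:
  assumes h: "h > 0" and cont: "continuous_on {0..} t"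
    and t: "\<And>c. 0 < c \<Longrightarrow> (t has_real_derivative t' c) (at c)"
    and rel: "\<And>c. 0 < c \<Longrightarrow> exp (q * (t c + (h - c))) * (t' c - 1) = K * exp (p * t c) * t' c"
    and c: "0 \<le> c" "c \<le> h" and d: "0 \<le> d" "d \<le> h"
  shows "E q (t c + (h - c)) - K * E p (t c) = E q (t d + (h - d)) - K * E p (t d)"
proof -
  define V where "V = (\<lambda>c. E q (t c + (h - c)) - K * E p (t c))"
  have contE: "continuous_on UNIV (E r)" for r
    using E_deriv by (rule DERIV_continuous_on[where D = "\<lambda>t. exp (r * t)"])
  have "continuous_on {0..h} t"
    by (rule continuous_on_subset[OF cont]) auto
  then have contV: "continuous_on {0..h} V"
    unfolding V_def by (intro continuous_intros continuous_on_compose2[OF contE]) auto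
  have const: "V x = V 0" if "x \<in> {0..h}" for x
  proof (rule DERIV_isconst2[OF h contV])
    fix c
    assume c: "0 < c" "c < h"
    have "(V has_real_derivative exp (q * (t c + (h - c))) * (t' c - 1) - K * (exp (p * t c) * t' c)) (at c)"
      unfolding V_def using c
      by (auto intro!: derivative_eq_intros DERIV_chain2[OF E_deriv] t)
    then show "(V has_real_derivative 0) (at c)"
      using rel[of c] c by (simp add: mult.assoc)
  qed (use that in auto)
  have "V c = V d"
    using const[of c] const[of d] c d by simp
  then show ?thesis
    by (simp add: V_def)
qed

text \<open>The constant is read off at \<open>c = h\<close>, where \<open>t = y = 0\<close>.
  Solving the logarithm of \<open>exp (q * y) = K * exp (p * t) / z\<close> for \<open>t\<close>
  gives \<open>tL\<close>; here \<open>z = (B + 1) / (B - 1)\<close> is the slope of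
  \<open>y\<close> in \<open>t\<close>, equal to \<open>K\<close> at \<open>c = h\<close>.\<close>

lemma left_branch:
  assumes h: "h > 0" and c: "0 \<le> c" "c \<le> h"
  shows "E q (tL h c + (h - c)) = exp (2 * a (- mu) (k / 4 * h)) * E p (tL h c)"
proof -
  define K where "K = exp (2 * a (- mu) (k / 4 * h))"
  have "E q (tL h c + (h - c)) - K * E p (tL h c) = E q (tL h h + (h - h)) - K * E p (tL h h)"
  proof (rule conserved_constant[OF h continuous_on_tL tL_deriv])
    fix c :: real
    assume "c > 0"
    then have s: "k / 4 * c > 0"
      using k_pos by simp
    define z where "z = exp (2 * a (- mu) (k / 4 * c))"
    define B where "B = A (- mu) (k / 4 * c)"
    have z: "z * (B - 1) = B + 1" "z > 0"
      using exp_2a[OF s, of "- mu"] by (auto simp: z_def B_def)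
    have "k * tL h c = 2 * (a (- mu) (k / 4 * h) - a (- mu) (k / 4 * c)) - q * (h - c)"
      using k_pos by (simp add: tL_def right_diff_distrib)
    then have "q * (tL h c + (h - c)) =
        p * tL h c + 2 * a (- mu) (k / 4 * h) - 2 * a (- mu) (k / 4 * c)"
      by (simp add: k_def algebra_simps)
    then have "exp (q * (tL h c + (h - c))) = exp (p * tL h c) * K / z"
      by (simp add: K_def z_def exp_add exp_diff)
    moreover have "- ((B - 1) / 2) - 1 = z * - ((B - 1) / 2)"
      using z(1) by (simp add: field_simps)
    ultimately show "exp (q * (tL h c + (h - c))) * (- ((A (- mu) (k / 4 * c) - 1) / 2) - 1) =
        K * exp (p * tL h c) * - ((A (- mu) (k / 4 * c) - 1) / 2)"
      using z(2) by (simp add: B_def)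
  qed (use h c in auto)
  then show ?thesis
    by (simp add: tL_h K_def)
qed

text \<open>As on the left, with slope \<open>1 / z\<close>; the constant is inherited at
  \<open>c = 0\<close>, where the branches meet.\<close>

lemma right_branch:
  assumes h: "h > 0" and c: "0 \<le> c" "c \<le> h"
  shows "E q (tR h c + (h - c)) = exp (2 * a (- mu) (k / 4 * h)) * E p (tR h c)"
proof -
  define K where "K = exp (2 * a (- mu) (k / 4 * h))"
  have "E q (tR h c + (h - c)) - K * E p (tR h c) = E q (tR h 0 + (h - 0)) - K * E p (tR h 0)"
  proof (rule conserved_constant[OF h continuous_on_tR tR_deriv])
    fix c :: real
    assume "c > 0"
    then have s: "k / 4 * c > 0"
      using k_pos by simp
    define z where "z = exp (2 * a mu (k / 4 * c))"
    define x where "x = A mu (k / 4 * c)"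
    have z: "z * (x - 1) = x + 1"
      using exp_2a[OF s, of mu] by (auto simp: z_def x_def)
    have "k * tR h c = 2 * (a mu (k / 4 * c) + a (- mu) (k / 4 * h)) - q * (h - c)"
      using k_pos by (simp add: tR_def right_diff_distrib)
    then have "q * (tR h c + (h - c)) =
        p * tR h c + 2 * a (- mu) (k / 4 * h) + 2 * a mu (k / 4 * c)"
      by (simp add: k_def algebra_simps)
    then have "exp (q * (tR h c + (h - c))) = exp (p * tR h c) * K * z"
      by (simp add: K_def z_def exp_add)
    moreover have "z * ((x + 1) / 2 - 1) = (x + 1) / 2"
      using z by (simp add: field_simps)
    ultimately show "exp (q * (tR h c + (h - c))) * ((A mu (k / 4 * c) + 1) / 2 - 1) =
        K * exp (p * tR h c) * ((A mu (k / 4 * c) + 1) / 2)"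
      by (simp add: x_def mult.assoc)
  qed (use h c in auto)
  moreover have "E q (tR h 0 + (h - 0)) = K * E p (tR h 0)"
    unfolding tR_0 K_def using h by (intro left_branch) auto
  ultimately show ?thesis
    by (simp add: K_def)
qed

section \<open>The endpoint as a function of the maximal gap\<close>

lemma L_deriv:
  assumes "h > 0"
  shows "(L has_real_derivative (A mu (k / 4 * h) + A (- mu) (k / 4 * h)) / 2) (at h)"
proof -
  have eq: "L = (\<lambda>h. 2 / k * (a mu (k / 4 * h) + a (- mu) (k / 4 * h)))"
    by (auto simp: L_def tR_def)
  have "(L has_real_derivative 2 / k * (k / 4 * (A mu (k / 4 * h) - mu) +
      k / 4 * (A (- mu) (k / 4 * h) - - mu))) (at h)"
    unfolding eq by (rule a_scaled_deriv[OF assms] derivative_eq_intros refl)+ simp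
  moreover have "2 / k * (k / 4 * (A mu (k / 4 * h) - mu) + k / 4 * (A (- mu) (k / 4 * h) - - mu)) =
      (A mu (k / 4 * h) + A (- mu) (k / 4 * h)) / 2"
    using k_pos by (simp add: field_simps)
  ultimately show ?thesis
    by (simp only:)
qed

lemma L_deriv_gt_1:
  assumes "h > 0"
  shows "(A mu (k / 4 * h) + A (- mu) (k / 4 * h)) / 2 > 1"
  using A_gt(1)[of "k / 4 * h" mu] A_gt(1)[of "k / 4 * h" "- mu"] assms k_pos by simp

lemma L_0: "L 0 = 0"
  by (simp add: L_def tR_def)

lemma continuous_on_L: "continuous_on {0..} L"
proof -
  have eq: "L = (\<lambda>h. 2 / k * (a mu (k / 4 * h) + a (- mu) (k / 4 * h)))"
    by (auto simp: L_def tR_def)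
  show ?thesis
    unfolding eq by (intro continuous_intros continuous_on_a_scaled)
qed

text \<open>Comparison with the identity yields both injectivity of \<open>L\<close> and the bound
  \<open>L h > h\<close> that makes \<open>L\<close> surjective.\<close>

lemma L_minus_id_mono:
  assumes "0 \<le> g" "g < h"
  shows "L g - g < L h - h"
proof (rule DERIV_pos_imp_increasing_open[OF assms(2)])
  show "continuous_on {g..h} (\<lambda>x. L x - x)"
    using assms by (intro continuous_intros continuous_on_subset[OF continuous_on_L]) auto
  fix x assume "g < x" "x < h"
  then have x: "x > 0"
    using assms by simp
  have "((\<lambda>x. L x - x) has_real_derivative (A mu (k / 4 * x) + A (- mu) (k / 4 * x)) / 2 - 1) (at x)"
    by (intro derivative_intros L_deriv x)
  then show "\<exists>y. ((\<lambda>x. L x - x) has_real_derivative y) (at x) \<and> 0 < y"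
    using L_deriv_gt_1[OF x] by (intro exI conjI) auto
qed

lemma L_gt: "h > 0 \<Longrightarrow> L h > h"
  using L_minus_id_mono[of 0 h] by (simp add: L_0)

lemma L_inj: "inj_on L {0..}"
proof (rule linorder_inj_onI')
  fix g h
  assume "g \<in> {0..}" "h \<in> {0..}" "g < (h :: real)"
  then show "L g \<noteq> L h"
    using L_minus_id_mono[of g h] by auto
qed

lemma L_surj:
  assumes "l > 0"
  shows "\<exists>h>0. L h = l"
proof -
  have "\<exists>h. 0 \<le> h \<and> h \<le> l \<and> L h = l"
    using assms L_gt[of l] by (intro IVT' continuous_on_subset[OF continuous_on_L]) (auto simp: L_0)
  then show ?thesis
    using assms L_0 by (metis less_eq_real_def less_irrefl)
qed

text \<open>One half of the bounded integrand, extended continuously to \<open>c = 0\<close>.\<close>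

definition Sig :: "real \<Rightarrow> real \<Rightarrow> real" where
  "Sig nu c = (if c = 0 then 2 / sqrt k else sqrt (1 - exp (- 2 * c)) * A nu (k / 4 * c))"

lemma scaled_at_right_0: "filterlim (\<lambda>c. k / 4 * c) (at_right 0) (at_right 0)"
proof -
  have "((\<lambda>c. k / 4 * c) \<longlongrightarrow> k / 4 * 0) (at_right 0)"
    by (intro tendsto_intros)
  then show ?thesis
    using k_pos eventually_at_right_less[of "0::real"]
    by (auto simp: filterlim_at elim!: eventually_mono)
qed

text \<open>The root vanishes like \<open>sqrt (2 * c)\<close> while \<open>A nu (k / 4 * c)\<close>
  grows like \<open>sqrt (2 / (k * c))\<close>.\<close>

lemma Sig_tendsto: "(Sig nu \<longlongrightarrow> 2 / sqrt k) (at_right 0)"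
proof -
  have lim: "((\<lambda>c::real. (1 - exp (- 2 * c)) / c) \<longlongrightarrow> 2) (at_right 0)"
    by real_asymp
  have "((\<lambda>c. sqrt ((1 - exp (- 2 * c)) / c * (4 / k)) * (sqrt (k / 4 * c) * A nu (k / 4 * c))) \<longlongrightarrow>
      sqrt (2 * (4 / k)) * sqrt (1 / 2)) (at_right 0)"
    by (intro tendsto_intros lim filterlim_compose[OF sqrt_s_A_tendsto scaled_at_right_0])
  moreover have "sqrt (2 * (4 / k)) * sqrt (1 / 2) = 2 / sqrt k"
  proof -
    have "sqrt (2 * (4 / k)) * sqrt (1 / 2) = sqrt (2\<^sup>2 / k)"
      by (simp add: real_sqrt_mult[symmetric])
    also have "\<dots> = 2 / sqrt k"
      unfolding real_sqrt_divide by simp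
    finally show ?thesis .
  qed
  ultimately have "((\<lambda>c. sqrt ((1 - exp (- 2 * c)) / c * (4 / k)) * (sqrt (k / 4 * c) * A nu (k / 4 * c))) \<longlongrightarrow>
      2 / sqrt k) (at_right 0)"
    by simp
  moreover have "\<forall>\<^sub>F c in at_right 0. sqrt ((1 - exp (- 2 * c)) / c * (4 / k)) * (sqrt (k / 4 * c) * A nu (k / 4 * c)) = Sig nu c"
    using eventually_at_right_less[of 0]
  proof eventually_elim
    case (elim c)
    have "sqrt ((1 - exp (- 2 * c)) / c * (4 / k)) * sqrt (k / 4 * c) = sqrt (1 - exp (- 2 * c))"
      using elim k_pos by (simp add: real_sqrt_mult[symmetric])
    then show ?case
      using elim by (simp add: Sig_def mult.assoc[symmetric])
  qed
  ultimately show ?thesis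
    by (rule Lim_transform_eventually)
qed

lemma A_scaled_deriv:
  assumes "c > 0"
  shows "((\<lambda>c. A nu (k / 4 * c)) has_real_derivative
    - ((A nu (k / 4 * c))\<^sup>2 - 1) * (A nu (k / 4 * c) - nu) * (k / 4)) (at c)"
  using assms k_pos by (intro DERIV_chain2[where f = "A nu"] A_deriv) (auto intro!: derivative_eq_intros)

lemma continuous_on_if_at_right_0:
  fixes f :: "real \<Rightarrow> real"
  assumes "\<And>c. c > 0 \<Longrightarrow> isCont f c" "(f \<longlongrightarrow> f 0) (at_right 0)"
  shows "continuous_on {0..} f"
  unfolding continuous_on_eq_continuous_within
proof
  fix c :: real
  assume "c \<in> {0..}"
  then consider "c = 0" | "c > 0"
    by fastforce
  then show "continuous (at c within {0..}) f"
  proof cases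
    case 1
    then show ?thesis
      using assms(2) by (simp add: continuous_within at_within_Ici_at_right)
  next
    case 2
    show ?thesis
      by (rule continuous_at_imp_continuous_within[OF assms(1)[OF 2]])
  qed
qed

lemma isCont_Sig:
  assumes "c > 0"
  shows "isCont (Sig nu) c"
proof -
  have "isCont (\<lambda>c. A nu (k / 4 * c)) c"
    using A_scaled_deriv[OF assms] by (rule DERIV_isCont)
  then have cont: "isCont (\<lambda>c. sqrt (1 - exp (- 2 * c)) * A nu (k / 4 * c)) c"
    by (intro continuous_intros) auto
  have "\<forall>\<^sub>F x in nhds c. sqrt (1 - exp (- 2 * x)) * A nu (k / 4 * x) = Sig nu x"
    by (rule eventually_mono[OF eventually_nhds_in_open[of "{0<..}" c]]) (use assms in \<open>auto simp: Sig_def\<close>)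
  then have "isCont (\<lambda>c. sqrt (1 - exp (- 2 * c)) * A nu (k / 4 * c)) c \<longleftrightarrow> isCont (Sig nu) c"
    by (rule isCont_cong)
  then show ?thesis
    using cont by (simp only:)
qed

lemma continuous_on_Sig: "continuous_on {0..} (Sig nu)"
  using isCont_Sig Sig_tendsto by (intro continuous_on_if_at_right_0) (auto simp: Sig_def)

definition S :: "real \<Rightarrow> real" where
  "S c = Sig mu c + Sig (- mu) c"

end

section \<open>Theta as an integral over the angle\<close>

context exponents
begin

lemma tR_0_less_L:
  assumes "h > 0"
  shows "tR h 0 < L h"
  unfolding L_def
proof (rule DERIV_pos_imp_increasing_open[OF assms])
  fix c :: real
  assume "0 < c"
  then show "\<exists>y. (tR h has_real_derivative y) (at c) \<and> 0 < y"
    using tR_deriv[of c h] A_gt(1)[of "k / 4 * c" mu] k_pos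
    by (intro exI[of _ "(A mu (k / 4 * c) + 1) / 2"] conjI) simp_all
qed (auto intro: continuous_on_subset[OF continuous_on_tR])

lemma tR_0_pos:
  assumes h: "h > 0"
  shows "0 < tR h 0"
proof -
  have "- tL h 0 < - tL h h"
  proof (rule DERIV_pos_imp_increasing_open[OF h])
    fix c :: real
    assume "0 < c"
    then show "\<exists>y. ((\<lambda>c. - tL h c) has_real_derivative y) (at c) \<and> 0 < y"
      using DERIV_minus[OF tL_deriv[of c h]] A_gt(1)[of "k / 4 * c" "- mu"] k_pos
      by (intro exI[of _ "(A (- mu) (k / 4 * c) - 1) / 2"] conjI) simp_all
  next
    show "continuous_on {0..h} (\<lambda>c. - tL h c)"
      by (intro continuous_intros continuous_on_subset[OF continuous_on_tL]) auto
  qed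
  then show ?thesis
    by (simp add: tL_h tR_0)
qed

text \<open>Where the gap is \<open>g\<close>, \<open>F\<close> equals
  \<open>x^2 * exp (2 * g)\<close>. The proportionality factor is the right one because the right
  branch at \<open>c = h\<close> gives \<open>y = t = L h\<close>.\<close>

lemma integrand_at_exp:
  assumes h: "h > 0" and t: "E q (t + g) = exp (2 * a (- mu) (k / 4 * h)) * E p t"
  shows "1 / sqrt (Theta_F p q (exp (L h)) (exp t) - (exp t)\<^sup>2) = 1 / (exp t * sqrt (exp (2 * g) - 1))"
proof -
  have "E q (L h) = exp (2 * a (- mu) (k / 4 * h)) * E p (L h)"
    using right_branch[OF h, of h] h by (simp add: L_def)
  then have "Theta_F p q (exp (L h)) (exp t) = exp (2 * (t + g))"
    using h L_gt[OF h] by (intro Theta_F_exp[OF less _ t]) auto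
  also have "\<dots> = (exp t)\<^sup>2 * exp (2 * g)"
    unfolding distrib_left exp_add exp_double ..
  finally have "Theta_F p q (exp (L h)) (exp t) - (exp t)\<^sup>2 = (exp t)\<^sup>2 * (exp (2 * g) - 1)"
    by (simp add: algebra_simps)
  then show ?thesis
    by (simp add: real_sqrt_mult)
qed

text \<open>The singular element \<open>dc / sqrt (exp (2 * (h - c)) - 1)\<close> per unit of the
  angle.\<close>

definition weight :: "real \<Rightarrow> real" where
  "weight c = sqrt (1 - exp (- 2 * c))"

lemma Sig_weight: "c > 0 \<Longrightarrow> Sig nu c = weight c * A nu (k / 4 * c)"
  by (simp add: Sig_def weight_def)

lemma continuous_on_weight_level: "h > 0 \<Longrightarrow> continuous_on T (\<lambda>\<theta>. weight (level h \<theta>))"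
  unfolding weight_def by (intro continuous_intros) auto

lemma continuous_on_compose_level:
  assumes "h > 0" "continuous_on {0..} f"
  shows "continuous_on T (\<lambda>\<theta>. f (level h \<theta>))"
  using assms by (intro continuous_on_compose2[OF assms(2)] continuous_intros) (auto intro: level_nonneg)

text \<open>On this branch \<open>dt = (A mu + 1) / 2 * dc\<close>, and \<open>x\<close> increases
  with the angle, from the point of maximal gap to the endpoint.\<close>

lemma right_integral:
  assumes h: "h > 0"
  shows "((\<lambda>x. 1 / sqrt (Theta_F p q (exp (L h)) x - x\<^sup>2)) has_integral
    integral {0..pi / 2} (\<lambda>\<theta>. (Sig mu (level h \<theta>) + weight (level h \<theta>)) / 2)) {exp (tR h 0)..exp (L h)}"
proof -
  define c' where "c' = (\<lambda>\<theta>. (exp (2 * h) - 1) * (sin \<theta> * cos \<theta>) / exp (2 * level h \<theta>))"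
  define X where "X = (\<lambda>\<theta>. exp (tR h (level h \<theta>)))"
  define X' where "X' = (\<lambda>\<theta>. X \<theta> * ((A mu (k / 4 * level h \<theta>) + 1) / 2 * c' \<theta>))"
  have "((\<lambda>x. 1 / sqrt (Theta_F p q (exp (L h)) x - x\<^sup>2)) has_integral
    integral {0..pi / 2} (\<lambda>\<theta>. (Sig mu (level h \<theta>) + weight (level h \<theta>)) / 2)) {X 0..X (pi / 2)}"
  proof (rule has_integral_parametrised_increasing[where X' = X'])
    show "continuous_on {0..pi / 2} X"
      unfolding X_def by (intro continuous_intros continuous_on_compose_level[OF h] continuous_on_tR)
    show "continuous_on {0..pi / 2} (\<lambda>\<theta>. (Sig mu (level h \<theta>) + weight (level h \<theta>)) / 2)"
      by (intro continuous_intros continuous_on_compose_level[OF h] continuous_on_Sig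
          continuous_on_weight_level[OF h]) auto
  next
    fix \<theta>
    assume \<theta>: "0 < \<theta>" "\<theta> < pi / 2"
    note c = level_strict_bounds[OF h \<theta>]
    have A1: "A mu (k / 4 * level h \<theta>) > 1"
      using c k_pos by (intro A_gt) simp
    have "((\<lambda>\<theta>. tR h (level h \<theta>)) has_real_derivative (A mu (k / 4 * level h \<theta>) + 1) / 2 * c' \<theta>) (at \<theta>)"
      unfolding c'_def using h by (intro DERIV_chain2[OF tR_deriv[OF c(1)] level_deriv_theta]) auto
    then show "(X has_real_derivative X' \<theta>) (at \<theta>)"
      unfolding X_def X'_def by (intro DERIV_chain2[OF DERIV_exp])
    have "c' \<theta> > 0"
      unfolding c'_def using h \<theta> by (intro divide_pos_pos mult_pos_pos sin_gt_zero cos_gt_zero) auto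
    then show "X' \<theta> > 0"
      unfolding X'_def X_def using A1 by simp
    have "1 / sqrt (Theta_F p q (exp (L h)) (X \<theta>) - (X \<theta>)\<^sup>2) * X' \<theta> =
        (A mu (k / 4 * level h \<theta>) + 1) / 2 * (c' \<theta> / sqrt (exp (2 * (h - level h \<theta>)) - 1))"
      unfolding X_def X'_def using c right_branch[OF h, of "level h \<theta>"]
      by (subst integrand_at_exp[OF h]) auto
    also have "c' \<theta> / sqrt (exp (2 * (h - level h \<theta>)) - 1) = weight (level h \<theta>)"
      unfolding c'_def weight_def by (rule level_weight[OF h \<theta>])
    finally show "1 / sqrt (Theta_F p q (exp (L h)) (X \<theta>) - (X \<theta>)\<^sup>2) * X' \<theta> =
        (Sig mu (level h \<theta>) + weight (level h \<theta>)) / 2"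
      unfolding Sig_weight[OF c(1)] by (simp add: field_simps)
  qed auto
  then show ?thesis
    by (simp add: X_def L_def)
qed

text \<open>On this branch \<open>dt = - (A (- mu) - 1) / 2 * dc\<close>, and \<open>x\<close>
  decreases with the angle. The weight enters with the opposite sign, so that it cancels in the sum
  of both branches.\<close>

lemma left_integral:
  assumes h: "h > 0"
  shows "((\<lambda>x. 1 / sqrt (Theta_F p q (exp (L h)) x - x\<^sup>2)) has_integral
    integral {0..pi / 2} (\<lambda>\<theta>. (Sig (- mu) (level h \<theta>) - weight (level h \<theta>)) / 2)) {1..exp (tR h 0)}"
proof -
  define c' where "c' = (\<lambda>\<theta>. (exp (2 * h) - 1) * (sin \<theta> * cos \<theta>) / exp (2 * level h \<theta>))"
  define X where "X = (\<lambda>\<theta>. exp (tL h (level h \<theta>)))"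
  define X' where "X' = (\<lambda>\<theta>. X \<theta> * ((A (- mu) (k / 4 * level h \<theta>) - 1) / 2 * c' \<theta>))"
  have "((\<lambda>x. 1 / sqrt (Theta_F p q (exp (L h)) x - x\<^sup>2)) has_integral
    integral {0..pi / 2} (\<lambda>\<theta>. (Sig (- mu) (level h \<theta>) - weight (level h \<theta>)) / 2)) {X (pi / 2)..X 0}"
  proof (rule has_integral_parametrised_decreasing[where X' = X'])
    show "continuous_on {0..pi / 2} X"
      unfolding X_def by (intro continuous_intros continuous_on_compose_level[OF h] continuous_on_tL)
    show "continuous_on {0..pi / 2} (\<lambda>\<theta>. (Sig (- mu) (level h \<theta>) - weight (level h \<theta>)) / 2)"
      by (intro continuous_intros continuous_on_compose_level[OF h] continuous_on_Sig
          continuous_on_weight_level[OF h]) auto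
  next
    fix \<theta>
    assume \<theta>: "0 < \<theta>" "\<theta> < pi / 2"
    note c = level_strict_bounds[OF h \<theta>]
    have A1: "A (- mu) (k / 4 * level h \<theta>) > 1"
      using c k_pos by (intro A_gt) simp
    have "((\<lambda>\<theta>. tL h (level h \<theta>)) has_real_derivative
        - ((A (- mu) (k / 4 * level h \<theta>) - 1) / 2) * c' \<theta>) (at \<theta>)"
      unfolding c'_def using h by (intro DERIV_chain2[OF tL_deriv[OF c(1)] level_deriv_theta]) auto
    then have "(X has_real_derivative X \<theta> * (- ((A (- mu) (k / 4 * level h \<theta>) - 1) / 2) * c' \<theta>)) (at \<theta>)"
      unfolding X_def by (intro DERIV_chain2[OF DERIV_exp])
    then show "(X has_real_derivative - X' \<theta>) (at \<theta>)"
      unfolding X'_def by (rule DERIV_cong) simp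
    have "c' \<theta> > 0"
      unfolding c'_def using h \<theta> by (intro divide_pos_pos mult_pos_pos sin_gt_zero cos_gt_zero) auto
    then show "X' \<theta> > 0"
      unfolding X'_def X_def using A1 by simp
    have "1 / sqrt (Theta_F p q (exp (L h)) (X \<theta>) - (X \<theta>)\<^sup>2) * X' \<theta> =
        (A (- mu) (k / 4 * level h \<theta>) - 1) / 2 * (c' \<theta> / sqrt (exp (2 * (h - level h \<theta>)) - 1))"
      unfolding X_def X'_def using c left_branch[OF h, of "level h \<theta>"]
      by (subst integrand_at_exp[OF h]) auto
    also have "c' \<theta> / sqrt (exp (2 * (h - level h \<theta>)) - 1) = weight (level h \<theta>)"
      unfolding c'_def weight_def by (rule level_weight[OF h \<theta>])
    finally show "1 / sqrt (Theta_F p q (exp (L h)) (X \<theta>) - (X \<theta>)\<^sup>2) * X' \<theta> =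
        (Sig (- mu) (level h \<theta>) - weight (level h \<theta>)) / 2"
      unfolding Sig_weight[OF c(1)] by (simp add: field_simps)
  qed auto
  then show ?thesis
    by (simp add: X_def tL_h tR_0)
qed

lemma continuous_on_S: "continuous_on {0..} S"
  unfolding S_def[abs_def] by (intro continuous_intros continuous_on_Sig)

lemma Theta_eq:
  assumes h: "h > 0"
  shows "Theta p q (exp (L h)) = integral {0..pi / 2} (\<lambda>\<theta>. S (level h \<theta>)) / 2"
proof -
  have integrable: "(\<lambda>\<theta>. (Sig nu (level h \<theta>) + weight (level h \<theta>)) / 2) integrable_on {0..pi / 2}"
    "(\<lambda>\<theta>. (Sig nu (level h \<theta>) - weight (level h \<theta>)) / 2) integrable_on {0..pi / 2}" for nu
    by (rule integrable_continuous_interval;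
        intro continuous_intros continuous_on_compose_level[OF h] continuous_on_Sig
          continuous_on_weight_level[OF h]; simp)+
  have "Theta p q (exp (L h)) =
      integral {0..pi / 2} (\<lambda>\<theta>. (Sig (- mu) (level h \<theta>) - weight (level h \<theta>)) / 2) +
      integral {0..pi / 2} (\<lambda>\<theta>. (Sig mu (level h \<theta>) + weight (level h \<theta>)) / 2)"
    unfolding Theta_def using tR_0_less_L[OF h] tR_0_pos[OF h]
    by (intro integral_unique has_integral_combine[OF _ _ left_integral[OF h] right_integral[OF h]]) auto
  also have "\<dots> = integral {0..pi / 2} (\<lambda>\<theta>. S (level h \<theta>) / 2)"
    by (subst Henstock_Kurzweil_Integration.integral_add[OF integrable(2,1), symmetric])
      (simp add: S_def add_divide_distrib diff_divide_distrib add.commute)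
  finally show ?thesis
    by simp
qed

end

subsection \<open>Differentiation in the height\<close>

context exponents
begin

definition S' :: "real \<Rightarrow> real" where
  "S' c = S c * (k / 4 * (G (8 / k) (k / 4 * c) - Q mu (k / 4 * c)))"

text \<open>This is the logarithmic derivative of \<open>sqrt (1 - exp (- 2 * c))\<close>, which
  explains the choice \<open>j = 8 / k\<close>.\<close>

lemma G_scaled: "k / 4 * G (8 / k) (k / 4 * c) = 1 / (exp (2 * c) - 1)"
  using k_pos by (simp add: G_def)

lemma S'_eq: "S' c = S c * (1 / (exp (2 * c) - 1) - k / 4 * Q mu (k / 4 * c))"
  unfolding S'_def right_diff_distrib[of "k / 4"] G_scaled ..

lemma S_pos:
  assumes "c > 0"
  shows "S c > 0"
proof -
  have "A nu (k / 4 * c) > 0" for nu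
    using A_gt(1)[of "k / 4 * c" nu] assms k_pos by simp
  then show ?thesis
    using assms by (simp add: S_def Sig_def add_pos_pos)
qed

text \<open>Logarithmic derivatives add: the root contributes \<open>G\<close>, the sum of the
  branches contributes \<open>- Q\<close>.\<close>

lemma S_deriv:
  assumes c: "c > 0"
  shows "(S has_real_derivative S' c) (at c)"
proof -
  define x where "x = A mu (k / 4 * c)"
  define y where "y = A (- mu) (k / 4 * c)"
  define x' where "x' = - (x\<^sup>2 - 1) * (x - mu) * (k / 4)"
  define y' where "y' = - (y\<^sup>2 - 1) * (y - - mu) * (k / 4)"
  define z where "z = 1 - exp (- 2 * c)"
  have z: "z > 0" "z = sqrt z * sqrt z"
    using c by (auto simp: z_def)
  have x': "((\<lambda>c. A mu (k / 4 * c)) has_real_derivative x') (at c)"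
    using A_scaled_deriv[OF c, of mu] by (simp add: x'_def x_def)
  have y': "((\<lambda>c. A (- mu) (k / 4 * c)) has_real_derivative y') (at c)"
    using A_scaled_deriv[OF c, of "- mu"] by (simp add: y'_def y_def)
  have w: "((\<lambda>c. sqrt (1 - exp (- 2 * c))) has_real_derivative (1 - z) / sqrt z) (at c)"
    using z(1) unfolding z_def
    by (auto intro!: derivative_eq_intros simp: field_simps)
  have deriv: "((\<lambda>c. sqrt (1 - exp (- 2 * c)) * (A mu (k / 4 * c) + A (- mu) (k / 4 * c))) has_real_derivative
      (1 - z) / sqrt z * (x + y) + (x' + y') * sqrt z) (at c)"
    using DERIV_mult[OF w DERIV_add[OF x' y']] by (simp add: x_def y_def z_def)
  define u where "u = 1 / (exp (2 * c) - 1)"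
  define v where "v = k / 4 * Q mu (k / 4 * c)"
  have 1: "x' + y' = - (k / 4 * (Q mu (k / 4 * c) * (x + y)))"
    unfolding x_def y_def Q_mult_sum unfolding x'_def y'_def x_def[symmetric] y_def[symmetric]
    by (simp add: algebra_simps)
  have 2: "(1 - z) / sqrt z = sqrt z * (1 / (exp (2 * c) - 1))"
  proof -
    have "exp (2 * c) - 1 > 0"
      using c by simp
    moreover have "(1 - z) * (exp (2 * c) - 1) = z"
      by (simp add: z_def algebra_simps exp_add[symmetric])
    ultimately show ?thesis
      using z by (simp add: field_simps)
  qed
  have 3: "S c = sqrt z * (x + y)"
    using c by (simp add: S_def Sig_def x_def y_def z_def algebra_simps)
  have "S' c = sqrt z * (x + y) * (u - v)"
    unfolding S'_eq 3 u_def v_def ..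
  then have "(1 - z) / sqrt z * (x + y) + (x' + y') * sqrt z = S' c"
    unfolding 1 2 u_def[symmetric] mult.assoc[symmetric, of "k / 4"] v_def[symmetric]
    by (simp add: algebra_simps)
  with deriv have "((\<lambda>c. sqrt (1 - exp (- 2 * c)) * (A mu (k / 4 * c) + A (- mu) (k / 4 * c))) has_real_derivative S' c) (at c)"
    by (simp only:)
  then show ?thesis
    by (rule has_field_derivative_transform_within_open[where S = "{0<..}"])
      (use c in \<open>auto simp: S_def Sig_def algebra_simps\<close>)
qed

text \<open>Only \<open>c * S' c \<longrightarrow> 0\<close> as \<open>c \<longrightarrow> 0\<close> is needed: the chain rule supplies a factor vanishing there.\<close>

definition R :: "real \<Rightarrow> real" where
  "R c = (if c = 0 then 0 else S' c * (1 - exp (- 2 * c)))"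

text \<open>Multiplied by \<open>c\<close>, both terms of \<open>S' / S\<close> tend to
  \<open>1 / 2\<close> in absolute value, so their singular parts cancel to leading order.\<close>

lemma R_tendsto: "(R \<longlongrightarrow> 0) (at_right 0)"
proof -
  have S: "(S \<longlongrightarrow> 2 / sqrt k + 2 / sqrt k) (at_right 0)"
    unfolding S_def[abs_def] by (intro tendsto_intros Sig_tendsto)
  have G: "((\<lambda>c::real. c / (exp (2 * c) - 1)) \<longlongrightarrow> 1 / 2) (at_right 0)"
    by real_asymp
  have E: "((\<lambda>c::real. (1 - exp (- 2 * c)) / c) \<longlongrightarrow> 2) (at_right 0)"
    by real_asymp
  have "((\<lambda>c. S c * (c / (exp (2 * c) - 1) - k / 4 * c * Q mu (k / 4 * c)) * ((1 - exp (- 2 * c)) / c)) \<longlongrightarrow>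
      (2 / sqrt k + 2 / sqrt k) * (1 / 2 - 1 / 2) * 2) (at_right 0)"
    by (intro tendsto_mult tendsto_diff S G E filterlim_compose[OF s_Q_tendsto scaled_at_right_0])
  then have *: "((\<lambda>c. S c * (c / (exp (2 * c) - 1) - k / 4 * c * Q mu (k / 4 * c)) * ((1 - exp (- 2 * c)) / c)) \<longlongrightarrow> 0)
      (at_right 0)"
    by simp
  show ?thesis
  proof (rule Lim_transform_eventually[OF *])
    show "\<forall>\<^sub>F c in at_right 0. S c * (c / (exp (2 * c) - 1) - k / 4 * c * Q mu (k / 4 * c)) * ((1 - exp (- 2 * c)) / c) = R c"
      using eventually_at_right_less[of 0]
    proof eventually_elim
      case (elim c)
      then show ?case
        by (simp add: R_def S'_eq field_simps)
    qed
  qed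
qed

lemma isCont_R:
  assumes c: "c > 0"
  shows "isCont R c"
proof -
  have "isCont S c"
    using S_deriv[OF c] by (rule DERIV_isCont)
  moreover have "isCont (\<lambda>c. Q mu (k / 4 * c)) c"
  proof -
    have "isCont (Q mu) (k / 4 * c)"
      using c k_pos by (intro DERIV_isCont[OF Q_deriv]) simp
    then show ?thesis
      by (rule isCont_o2[where f = "\<lambda>c. k / 4 * c", rotated]) simp
  qed
  ultimately have cont: "isCont (\<lambda>c. S c * (1 / (exp (2 * c) - 1) - k / 4 * Q mu (k / 4 * c)) * (1 - exp (- 2 * c))) c"
    using c by (intro continuous_intros) auto
  have "\<forall>\<^sub>F x in nhds c. S x * (1 / (exp (2 * x) - 1) - k / 4 * Q mu (k / 4 * x)) * (1 - exp (- 2 * x)) = R x"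
    by (rule eventually_mono[OF eventually_nhds_in_open[of "{0<..}" c]])
      (use c in \<open>auto simp: R_def S'_eq\<close>)
  then have "isCont (\<lambda>c. S c * (1 / (exp (2 * c) - 1) - k / 4 * Q mu (k / 4 * c)) * (1 - exp (- 2 * c))) c \<longleftrightarrow> isCont R c"
    by (rule isCont_cong)
  then show ?thesis
    using cont by (simp only:)
qed

lemma continuous_on_R: "continuous_on {0..} R"
  using isCont_R R_tendsto by (intro continuous_on_if_at_right_0) (auto simp: R_def)

section \<open>Differentiation under the integral sign\<close>

definition T :: "real \<Rightarrow> real" where
  "T h = integral {0..pi / 2} (\<lambda>\<theta>. S (level h \<theta>)) / 2"

definition T' :: "real \<Rightarrow> real" where
  "T' h = integral {0..pi / 2} (\<lambda>\<theta>. R (level h \<theta>) * (exp (2 * h) / (exp (2 * h) - 1))) / 2"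

lemma level_pos:
  assumes "h > 0" "0 < \<theta>" "\<theta> \<le> pi / 2"
  shows "level h \<theta> > 0"
proof (cases "\<theta> = pi / 2")
  case True
  then show ?thesis
    using assms(1) by (simp only: level_pi_half)
next
  case False
  then show ?thesis
    using assms level_strict_bounds(1)[of h \<theta>] by simp
qed

text \<open>The derivative of the level in \<open>h\<close> is
  \<open>1 - exp (- 2 * level h \<theta>)\<close> times a factor depending on \<open>h\<close>
  alone, which produces \<open>R\<close>. At angle 0 the level is constantly 0 and
  \<open>R 0 = 0\<close>.\<close>

lemma S_level_deriv:
  assumes h: "h > 0" and \<theta>: "0 \<le> \<theta>" "\<theta> \<le> pi / 2"
  shows "((\<lambda>h. S (level h \<theta>)) has_real_derivative
    R (level h \<theta>) * (exp (2 * h) / (exp (2 * h) - 1))) (at h)"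
proof (cases "\<theta> = 0")
  case True
  then show ?thesis
    by (simp add: R_def)
next
  case False
  then have pos: "level h \<theta> > 0"
    using assms by (intro level_pos) auto
  have "((\<lambda>h. S (level h \<theta>)) has_real_derivative
      S' (level h \<theta>) * (exp (2 * h) * (sin \<theta>)\<^sup>2 / exp (2 * level h \<theta>))) (at h)"
    using h by (intro DERIV_chain2[OF S_deriv[OF pos] level_deriv_h]) auto
  moreover have "exp (2 * h) - 1 > 0"
    using h by simp
  then have "S' (level h \<theta>) * (exp (2 * h) * (sin \<theta>)\<^sup>2 / exp (2 * level h \<theta>)) =
      R (level h \<theta>) * (exp (2 * h) / (exp (2 * h) - 1))"
    using pos h unfolding R_def by (simp add: one_minus_exp_level[simplified])
  ultimately show ?thesis
    by (simp only:)
qed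

lemma T_deriv:
  assumes h: "h > 0"
  shows "(T has_real_derivative T' h) (at h)"
proof -
  define fx where "fx = (\<lambda>h \<theta>. R (level h \<theta>) * (exp (2 * h) / (exp (2 * h) - 1)))"
  have "((\<lambda>h. integral (cbox 0 (pi / 2)) (\<lambda>\<theta>. S (level h \<theta>))) has_real_derivative
      integral (cbox 0 (pi / 2)) (fx h)) (at h within {0<..})"
  proof (rule leibniz_rule_field_derivative)
    show "((\<lambda>h. S (level h \<theta>)) has_real_derivative fx h \<theta>) (at h within {0<..})"
      if "h \<in> {0<..}" "\<theta> \<in> cbox 0 (pi / 2)" for h \<theta>
      unfolding fx_def
      by (rule has_field_derivative_at_within[OF S_level_deriv]) (use that in auto)
    show "(\<lambda>\<theta>. S (level h \<theta>)) integrable_on cbox 0 (pi / 2)" if "h \<in> {0<..}" for h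
      using that by (intro integrable_continuous continuous_on_compose_level continuous_on_S) auto
    \<comment> \<open>Angle 0 is included because \<open>R\<close> is continuous at 0.\<close>
    have "continuous_on ({0<..} \<times> cbox 0 (pi / 2)) (\<lambda>x. R (level (fst x) (snd x)))"
      by (rule continuous_on_compose2[OF continuous_on_R])
        (auto intro!: continuous_intros level_nonneg)
    then show "continuous_on ({0<..} \<times> cbox 0 (pi / 2)) (\<lambda>(h, \<theta>). fx h \<theta>)"
      unfolding fx_def split_def by (intro continuous_intros) auto
  qed (use h in auto)
  then have "((\<lambda>h. integral {0..pi / 2} (\<lambda>\<theta>. S (level h \<theta>))) has_real_derivative
      integral {0..pi / 2} (fx h)) (at h)"
    using h by (simp add: at_within_open[of h "{0<..}"])
  from DERIV_cdivide[OF this, of 2] show ?thesis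
    unfolding T_def[abs_def] T'_def fx_def .
qed

text \<open>At interior angles the integrand is a positive multiple of \<open>G - Q\<close>, and it
  is continuous up to the ends.\<close>

lemma T'_sign:
  assumes h: "h > 0"
  shows "(\<And>s. s > 0 \<Longrightarrow> Q mu s < G (8 / k) s) \<Longrightarrow> T' h > 0"
    and "(\<And>s. s > 0 \<Longrightarrow> Q mu s > G (8 / k) s) \<Longrightarrow> T' h < 0"
proof -
  define f where "f = (\<lambda>\<theta>. R (level h \<theta>) * (exp (2 * h) / (exp (2 * h) - 1)))"
  have T': "T' h = integral {0..pi / 2} f / 2"
    by (simp only: T'_def f_def)
  have cont: "continuous_on {0..pi / 2} f"
    unfolding f_def using h
    by (intro continuous_intros continuous_on_compose_level continuous_on_R) auto
  have E: "exp (2 * h) / (exp (2 * h) - 1) > 0"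
    using h by simp
  have f: "f \<theta> = S' (level h \<theta>) * (1 - exp (- 2 * level h \<theta>)) * (exp (2 * h) / (exp (2 * h) - 1))"
    if "\<theta> \<in> {0<..<pi / 2}" for \<theta>
    using level_pos[OF h, of \<theta>] that by (simp add: f_def R_def)
  have pos: "level h \<theta> > 0" "k / 4 * level h \<theta> > 0" "S (level h \<theta>) > 0" "1 - exp (- 2 * level h \<theta>) > 0"
    if "\<theta> \<in> {0<..<pi / 2}" for \<theta>
    using level_pos[OF h, of \<theta>] S_pos[of "level h \<theta>"] that k_pos by auto
  show "T' h > 0" if *: "\<And>s. s > 0 \<Longrightarrow> Q mu s < G (8 / k) s"
  proof -
    have "integral {0..pi / 2} (\<lambda>_. 0) < integral {0..pi / 2} f"
    proof (rule integral_less_real)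
      fix \<theta>
      assume \<theta>: "\<theta> \<in> {0<..<pi / 2}"
      show "0 < f \<theta>"
        unfolding f[OF \<theta>] S'_def using pos[OF \<theta>] *[OF pos(2)[OF \<theta>]] E k_pos
        by (intro mult_pos_pos) simp_all
    qed (use cont in \<open>auto simp: not_le\<close>)
    then show ?thesis
      unfolding T' by simp
  qed
  show "T' h < 0" if *: "\<And>s. s > 0 \<Longrightarrow> Q mu s > G (8 / k) s"
  proof -
    have "integral {0..pi / 2} f < integral {0..pi / 2} (\<lambda>_. 0)"
    proof (rule integral_less_real)
      fix \<theta>
      assume \<theta>: "\<theta> \<in> {0<..<pi / 2}"
      show "f \<theta> < 0"
        unfolding f[OF \<theta>] S'_def using pos[OF \<theta>] *[OF pos(2)[OF \<theta>]] E k_pos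
        by (intro mult_neg_pos mult_pos_neg) simp_all
    qed (use cont in \<open>auto simp: not_le\<close>)
    then show ?thesis
      unfolding T' by simp
  qed
qed

text \<open>Chain rule through the inverse of \<open>exp (L h)\<close>. As that function has
  positive derivative, the derivative in \<open>r\<close> has the sign of
  \<open>T' h\<close>.\<close>

lemma Theta_deriv:
  assumes r: "r > 1"
  obtains h D where "h > 0" "D > 0" "((\<lambda>s. Theta p q s) has_real_derivative T' h * D) (at r)"
proof -
  obtain h where h: "h > 0" "L h = ln r"
    using L_surj[of "ln r"] r by auto
  define f where "f = (\<lambda>h. exp (L h))"
  define g where "g = the_inv_into {0<..} f"
  have inj: "inj_on f {0<..}"
    using L_inj by (auto simp: f_def inj_on_def)
  have fg: "g (f x) = x" if "x > 0" for x
    unfolding g_def using that inj by (intro the_inv_into_f_f) auto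
  define D where "D = exp (L h) * ((A mu (k / 4 * h) + A (- mu) (k / 4 * h)) / 2)"
  have D: "D > 0"
    using L_deriv_gt_1[OF h(1)] by (simp add: D_def)
  have fr: "f h = r"
    using h r by (simp add: f_def)
  have "(g has_real_derivative inverse D) (at (f h))"
  proof (rule has_field_derivative_inverse_strong[where f = f and S = "{0<..}"])
    show "(f has_real_derivative D) (at h)"
      unfolding f_def D_def by (intro DERIV_chain2[OF DERIV_exp] L_deriv h)
    show "continuous_on {0<..} f"
      unfolding f_def by (intro continuous_intros continuous_on_subset[OF continuous_on_L]) auto
  qed (use D h fg in auto)
  then have "((\<lambda>s. T (g s)) has_real_derivative T' h * inverse D) (at r)"
    using T_deriv[OF h(1)] fg[OF h(1)] unfolding fr by (intro DERIV_chain2[of T]) auto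
  then have "((\<lambda>s. Theta p q s) has_real_derivative T' h * inverse D) (at r)"
  proof (rule has_field_derivative_transform_within_open[where S = "{1<..}"])
    fix s :: real
    assume "s \<in> {1<..}"
    then obtain x where x: "x > 0" "L x = ln s"
      using L_surj[of "ln s"] by auto
    then have "f x = s"
      using \<open>s \<in> {1<..}\<close> by (simp add: f_def)
    then show "T (g s) = Theta p q s"
      using fg[OF x(1)] Theta_eq[OF x(1)] by (auto simp: T_def f_def)
  qed (use r in auto)
  then show ?thesis
    using that[OF h(1), of "inverse D"] D by simp
qed

lemma Theta_deriv_pos:
  assumes "r > 1"
    and "(8 / k \<le> 2 * (1 - \<bar>mu\<bar>) \<and> (mu, 8 / k) \<noteq> (0, 2)) \<or>
      (\<bar>mu\<bar> > 1 \<and> 8 / k \<le> mu\<^sup>2 - 1 \<and> 8 / k \<le> 2 * (\<bar>mu\<bar> + 1) \<and> (\<bar>mu\<bar>, 8 / k) \<noteq> (3, 8))"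
  shows "\<exists>D. ((\<lambda>s. Theta p q s) has_real_derivative D) (at r) \<and> D > 0"
proof -
  obtain h D where D: "h > 0" "D > 0" "((\<lambda>s. Theta p q s) has_real_derivative T' h * D) (at r)"
    using Theta_deriv[OF assms(1)] .
  have "T' h > 0"
    using k_pos assms(2) by (intro T'_sign(1)[OF D(1)] Q_less_G_cases) auto
  then show ?thesis
    using D by (intro exI[of _ "T' h * D"]) auto
qed

lemma Theta_deriv_neg:
  assumes "r > 1"
    and "8 / k \<ge> 2 * (1 + \<bar>mu\<bar>)" "8 / k \<ge> mu\<^sup>2 - 1" "(\<bar>mu\<bar>, 8 / k) \<notin> {(0, 2), (3, 8)}"
  shows "\<exists>D. ((\<lambda>s. Theta p q s) has_real_derivative D) (at r) \<and> D < 0"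
proof -
  obtain h D where D: "h > 0" "D > 0" "((\<lambda>s. Theta p q s) has_real_derivative T' h * D) (at r)"
    using Theta_deriv[OF assms(1)] .
  have "T' h < 0"
    using k_pos assms by (intro T'_sign(2)[OF D(1)] Q_greater_G_cases) auto
  then show ?thesis
    using D by (intro exI[of _ "T' h * D"]) (auto intro: mult_neg_pos)
qed

end

subsection \<open>Translation of the exponent conditions\<close>

context exponents
begin

text \<open>Because \<open>1 - mu = - 2 * p / k\<close> and \<open>1 + mu = 2 * q / k\<close>, the
  thresholds for \<open>j = 8 / k\<close> turn into the lines \<open>p = -2\<close> and
  \<open>q = 2\<close> and the curve \<open>p * q = 2 * (q - p)\<close>.\<close>

lemma conditions_eq:
  "2 * (1 - mu) - 8 / k = - (4 * (p + 2) / k)"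
  "2 * (1 + mu) - 8 / k = 4 * (q - 2) / k"
  "mu\<^sup>2 - 1 - 8 / k = 4 * (p * q - 2 * (q - p)) / k\<^sup>2"
proof -
  have k: "k \<noteq> 0"
    using k_pos by simp
  have mu: "1 - mu = - (2 * p) / k" "1 + mu = 2 * q / k"
    using k by (simp_all add: mu_def field_simps) (simp_all add: k_def algebra_simps)
  show "2 * (1 - mu) - 8 / k = - (4 * (p + 2) / k)" "2 * (1 + mu) - 8 / k = 4 * (q - 2) / k"
    unfolding mu using k by (simp_all add: field_simps)
  have "mu\<^sup>2 - 1 = - ((1 - mu) * (1 + mu))"
    by (simp add: power2_eq_square algebra_simps)
  also have "\<dots> = 4 * (p * q) / k\<^sup>2"
    unfolding mu by (simp add: power2_eq_square)
  finally have "mu\<^sup>2 - 1 = 4 * (p * q) / k\<^sup>2" .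
  moreover have "8 / k = 4 * (2 * (q - p)) / k\<^sup>2"
    using k unfolding k_def[symmetric] by (simp add: power2_eq_square)
  ultimately show "mu\<^sup>2 - 1 - 8 / k = 4 * (p * q - 2 * (q - p)) / k\<^sup>2"
    by (simp add: diff_divide_distrib right_diff_distrib)
qed

lemma conditions_iff:
  "8 / k \<le> 2 * (1 - mu) \<longleftrightarrow> p \<le> -2" "8 / k \<ge> 2 * (1 - mu) \<longleftrightarrow> p \<ge> -2"
  "8 / k \<le> 2 * (1 + mu) \<longleftrightarrow> q \<ge> 2" "8 / k \<ge> 2 * (1 + mu) \<longleftrightarrow> q \<le> 2"
  "8 / k \<le> mu\<^sup>2 - 1 \<longleftrightarrow> p * q \<ge> 2 * (q - p)" "8 / k \<ge> mu\<^sup>2 - 1 \<longleftrightarrow> p * q \<le> 2 * (q - p)"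
proof -
  have k2: "k\<^sup>2 > 0"
    using k_pos by simp
  have le: "x \<le> y \<longleftrightarrow> y - x \<ge> 0" "x \<ge> y \<longleftrightarrow> y - x \<le> 0" for x y :: real
    by auto
  show "8 / k \<le> 2 * (1 - mu) \<longleftrightarrow> p \<le> -2" "8 / k \<ge> 2 * (1 - mu) \<longleftrightarrow> p \<ge> -2"
    unfolding le[where x = "8 / k"] conditions_eq using k_pos
    by (auto simp: zero_le_divide_iff divide_le_0_iff)
  show "8 / k \<le> 2 * (1 + mu) \<longleftrightarrow> q \<ge> 2" "8 / k \<ge> 2 * (1 + mu) \<longleftrightarrow> q \<le> 2"
    unfolding le[where x = "8 / k"] conditions_eq using k_pos
    by (auto simp: zero_le_divide_iff divide_le_0_iff)
  show "8 / k \<le> mu\<^sup>2 - 1 \<longleftrightarrow> p * q \<ge> 2 * (q - p)" "8 / k \<ge> mu\<^sup>2 - 1 \<longleftrightarrow> p * q \<le> 2 * (q - p)"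
    unfolding le[where x = "8 / k"] conditions_eq using k2
    by (auto simp: zero_le_divide_iff divide_le_0_iff)
qed

text \<open>At these parameters the defect is identically 0; they correspond to corners of the
  regions.\<close>

lemma exceptional:
  "mu = 0 \<Longrightarrow> 8 / k = 2 \<Longrightarrow> (p, q) = (-2, 2)"
  "\<bar>mu\<bar> = 3 \<Longrightarrow> 8 / k = 8 \<Longrightarrow> (p, q) = (1, 2) \<or> (p, q) = (-2, -1)"
proof -
  have mu: "mu * k = p + q"
    using k_pos by (simp add: mu_def)
  show "(p, q) = (-2, 2)" if "mu = 0" "8 / k = 2"
  proof -
    have "k = 4"
      using that k_pos by (simp add: field_simps)
    then show ?thesis
      using mu that by (auto simp: k_def)
  qed
  show "(p, q) = (1, 2) \<or> (p, q) = (-2, -1)" if "\<bar>mu\<bar> = 3" "8 / k = 8"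
  proof -
    have "k = 1"
      using that k_pos by (simp add: field_simps)
    moreover have "mu = 3 \<or> mu = -3"
      using that by auto
    ultimately show ?thesis
      using mu by (auto simp: k_def)
  qed
qed

lemma mu_gt_iff: "mu > 1 \<longleftrightarrow> p > 0" "mu < -1 \<longleftrightarrow> q < 0"
  using less by (auto simp: mu_def k_def field_simps)

end

theorem theorem6p4:
  fixes p q :: real
  assumes "p < q"
  shows "(p \<le> -2 \<and> q \<ge> 2 \<and> (p, q) \<noteq> (-2, 2) \<longrightarrow>
            (\<forall>r>1. \<exists>D. ((\<lambda>s. Theta p q s) has_real_derivative D) (at r) \<and> D > 0))
       \<and> (q \<ge> 2 \<and> p \<ge> 2 * q / (2 + q) \<and> (p, q) \<noteq> (1, 2) \<longrightarrow>
            (\<forall>r>1. \<exists>D. ((\<lambda>s. Theta p q s) has_real_derivative D) (at r) \<and> D > 0))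
       \<and> (p \<le> -2 \<and> q \<le> 2 * p / (2 - p) \<and> (p, q) \<noteq> (-2, -1) \<longrightarrow>
            (\<forall>r>1. \<exists>D. ((\<lambda>s. Theta p q s) has_real_derivative D) (at r) \<and> D > 0))
       \<and> (q \<ge> 2 * p / (2 - p) \<and> p \<ge> -2 \<and> q \<le> 2 \<and>
          (p, q) \<notin> {(0, 0), (1, 2), (-2, -1), (-2, 2)} \<longrightarrow>
            (\<forall>r>1. \<exists>D. ((\<lambda>s. Theta p q s) has_real_derivative D) (at r) \<and> D < 0))"
proof -
  interpret exponents p q
    by unfold_locales (rule assms)
  show ?thesis
  proof (intro conjI impI allI)
    fix r :: real
    assume pq: "p \<le> -2 \<and> q \<ge> 2 \<and> (p, q) \<noteq> (-2, 2)" and r: "r > 1"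
    \<comment> \<open>The bound with the absolute value combines those for \<open>mu\<close> and
      \<open>- mu\<close>, that is, \<open>p \<le> -2\<close> and \<open>q \<ge> 2\<close>.\<close>
    have "8 / k \<le> 2 * (1 - \<bar>mu\<bar>)"
      using conditions_iff(1,3) pq by (cases "mu \<ge> 0") auto
    moreover have "(mu, 8 / k) \<noteq> (0, 2)"
      using exceptional(1) pq by blast
    ultimately show "\<exists>D. ((\<lambda>s. Theta p q s) has_real_derivative D) (at r) \<and> D > 0"
      by (intro Theta_deriv_pos[OF r] disjI1 conjI)
  next
    fix r :: real
    assume pq: "q \<ge> 2 \<and> p \<ge> 2 * q / (2 + q) \<and> (p, q) \<noteq> (1, 2)" and r: "r > 1"
    \<comment> \<open>Positivity of \<open>p\<close> gives \<open>mu > 1\<close>, so that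
      \<open>\<bar>mu\<bar>\<close> is \<open>mu\<close>.\<close>
    have "2 * q / (2 + q) > 0"
      using pq by simp
    then have "p > 0"
      using pq by linarith
    then have p: "p > 0" "mu > 1"
      using mu_gt_iff(1) by auto
    have "p * q \<ge> 2 * (q - p)"
      using pq pos_divide_le_eq[of "2 + q" "2 * q" p] by (simp add: algebra_simps)
    then have "8 / k \<le> mu\<^sup>2 - 1" "8 / k \<le> 2 * (\<bar>mu\<bar> + 1)"
      using conditions_iff(3,5) pq p by auto
    moreover have "(\<bar>mu\<bar>, 8 / k) \<noteq> (3, 8)"
      using exceptional(2) pq p by auto
    ultimately show "\<exists>D. ((\<lambda>s. Theta p q s) has_real_derivative D) (at r) \<and> D > 0"
      using p by (intro Theta_deriv_pos[OF r] disjI2 conjI) auto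
  next
    fix r :: real
    assume pq: "p \<le> -2 \<and> q \<le> 2 * p / (2 - p) \<and> (p, q) \<noteq> (-2, -1)" and r: "r > 1"
    \<comment> \<open>Negativity of \<open>q\<close> gives \<open>mu < -1\<close>; then
      \<open>\<bar>mu\<bar> + 1\<close> is \<open>1 - mu\<close>, and \<open>p \<le> -2\<close>
      provides the second bound.\<close>
    have "2 * p / (2 - p) < 0"
      using pq by (intro divide_neg_pos) auto
    then have "q < 0"
      using pq by linarith
    then have q: "q < 0" "mu < -1"
      using mu_gt_iff(2) by auto
    have "p * q \<ge> 2 * (q - p)"
      using pq pos_le_divide_eq[of "2 - p" q "2 * p"] by (simp add: algebra_simps)
    then have "8 / k \<le> mu\<^sup>2 - 1" "8 / k \<le> 2 * (\<bar>mu\<bar> + 1)"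
      using conditions_iff(1,5) pq q by auto
    moreover have "(\<bar>mu\<bar>, 8 / k) \<noteq> (3, 8)"
      using exceptional(2) pq q by auto
    ultimately show "\<exists>D. ((\<lambda>s. Theta p q s) has_real_derivative D) (at r) \<and> D > 0"
      using q by (intro Theta_deriv_pos[OF r] disjI2 conjI) auto
  next
    fix r :: real
    assume pq: "q \<ge> 2 * p / (2 - p) \<and> p \<ge> -2 \<and> q \<le> 2 \<and>
      (p, q) \<notin> {(0, 0), (1, 2), (-2, -1), (-2, 2)}" and r: "r > 1"
    \<comment> \<open>The denominator \<open>2 - p\<close> is positive because
      \<open>p < q \<le> 2\<close>.\<close>
    have "p * q \<le> 2 * (q - p)"
      using pq assms pos_divide_le_eq[of "2 - p" "2 * p" q] by (simp add: algebra_simps)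
    then have "8 / k \<ge> mu\<^sup>2 - 1" "8 / k \<ge> 2 * (1 + \<bar>mu\<bar>)"
      using conditions_iff(2,4,6) pq by (auto simp: abs_if)
    moreover have "(\<bar>mu\<bar>, 8 / k) \<notin> {(0, 2), (3, 8)}"
      using exceptional pq by auto
    ultimately show "\<exists>D. ((\<lambda>s. Theta p q s) has_real_derivative D) (at r) \<and> D < 0"
      by (intro Theta_deriv_neg[OF r])
  qed
qed

end
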